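(* Let $n$ be a positive integer, let $H$ be a digraph with chromatic number $\chi(H)=12n-5$ that contains a Hamiltonian directed path, and let $C$ be an oriented cycle of order $n$ with more than one block. Then $H$ contains a subdivision of $C$ (as a subdigraph).
   Context: All graphs are finite and simple (no loops, no multiple edges). A digraph (oriented graph) is obtained from a simple graph by assigning exactly one direction to each edge; in particular it has no loops, no parallel arcs, and no pair of opposite arcs $(u,v),(v,u)$. The underlying graph $G(D)$ of a digraph $D$ is the graph obtained by ignoring the arc directions, and the chromatic number $\chi(D)$ is $\chi(G(D))$; a $k$-chromatic digraph is one with chromatic number $k$. A Hamiltonian directed path of a digraph is a directed path (all arcs consistently oriented) passing through all its vertices. An oriented cycle is a digraph whose underlying graph is a cycle (its arcs may be oriented arbitrarily); its order is its number of vertices (so the order is at least $3$). A block of a non-directed oriented cycle is a maximal directed subpath of it; an oriented cycle has more than one block exactly when it is not a directed cycle. A subdivision of a digraph $F$ is a digraph obtained from $F$ by replacing each arc $(x,y)$ with a directed path from $x$ to $y$ of length at least $1$ (the replacing paths being pairwise internally disjoint, with new internal vertices). *)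

theory Defs
  imports "Graph_Theory.Graph_Theory"
begin

text \<open>
  Digraphs without parallel arcs are taken from the library (arcs are ordered pairs of vertices,
  finitely many vertices, no loops); an oriented graph moreover has no pair of opposite arcs. An
  undirected graph is, as in the library, a symmetric digraph, and \<^term>\<open>mk_symmetric D\<close> is the
  underlying graph of \<^term>\<open>D\<close>.
\<close>

locale oriented_graph = pair_digraph G for G :: "'a pair_pre_digraph" +
  assumes no_opposite_arcs: "(u, v) \<in> parcs G \<Longrightarrow> (v, u) \<notin> parcs G"

definition proper_coloring :: "('a, 'b) pre_digraph \<Rightarrow> nat \<Rightarrow> ('a \<Rightarrow> nat) \<Rightarrow> bool" where
  "proper_coloring G k c \<longleftrightarrow>
     (\<forall>v \<in> verts G. c v < k) \<and> (\<forall>(u, v) \<in> arcs_ends G. c u \<noteq> c v)"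

definition graph_chromatic_number :: "('a, 'b) pre_digraph \<Rightarrow> nat" where
  "graph_chromatic_number G = (LEAST k. \<exists>c. proper_coloring G k c)"

definition chromatic_number :: "'a pair_pre_digraph \<Rightarrow> nat" where
  "chromatic_number D = graph_chromatic_number (mk_symmetric D)"

definition has_hamiltonian_dipath :: "('a, 'b) pre_digraph \<Rightarrow> bool" where
  "has_hamiltonian_dipath D \<longleftrightarrow>
     (\<exists>u p v. pre_digraph.apath D u p v \<and> set (pre_digraph.awalk_verts D u p) = verts D)"

text \<open>
  In a symmetric digraph the library's \<^const>\<open>pre_digraph.cycle\<close> also admits the closed walk going
  back and forth along a single edge, hence the explicit length bound.
\<close>

definition is_cycle_graph :: "'a pair_pre_digraph \<Rightarrow> bool" where
  "is_cycle_graph G \<longleftrightarrow>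
     (\<exists>p. pre_digraph.cycle G p \<and> 3 \<le> length p \<and>
          pverts G = fst ` set p \<and> parcs G = set p \<union> (set p)\<inverse>)"

definition oriented_cycle :: "'a pair_pre_digraph \<Rightarrow> bool" where
  "oriented_cycle D \<longleftrightarrow> oriented_graph D \<and> is_cycle_graph (mk_symmetric D)"

definition directed_cycle :: "'a pair_pre_digraph \<Rightarrow> bool" where
  "directed_cycle D \<longleftrightarrow>
     (\<exists>p. pre_digraph.cycle D p \<and> pverts D = fst ` set p \<and> parcs D = set p)"

definition dipath :: "'a pair_pre_digraph \<Rightarrow> ('a \<times> 'a) list \<Rightarrow> bool" where
  "dipath D p \<longleftrightarrow> (\<exists>u v. pre_digraph.apath D u p v)"

text \<open>
  A directed path is given by its list of arcs. A path of length 0 is a subpath of a path of length 1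
  as soon as \<^term>\<open>D\<close> has an arc at all, and a path of positive length is determined by its set of
  arcs, so maximality may be tested on the latter.
\<close>

definition blocks :: "'a pair_pre_digraph \<Rightarrow> ('a \<times> 'a) list set" where
  "blocks D = {p. dipath D p \<and> (\<forall>q. dipath D q \<longrightarrow> \<not> set p \<subset> set q)}"

text \<open>
  Blocks are only meant for oriented cycles that are not directed: a directed cycle of order
  \<^term>\<open>n\<close> has \<^term>\<open>n\<close> maximal directed subpaths but does not count as having more than one block.
  The lemma \<open>more_than_one_block_iff\<close> below confirms that the requirement on
  \<^const>\<open>blocks\<close> holds for all others.
\<close>

definition more_than_one_block :: "'a pair_pre_digraph \<Rightarrow> bool" where
  "more_than_one_block D \<longleftrightarrow> \<not> directed_cycle D \<and> 1 < card (blocks D)"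

lemma pcas_verts:
  assumes "pcas u p v"
  shows "pawalk_verts u p = u # map snd p" "pawalk_verts u p = map fst p @ [v]"
  using assms by (induct p arbitrary: u) auto

lemma pcas_append:
  "pcas u (p @ q) v \<longleftrightarrow> (\<exists>w. pcas u p w \<and> pcas w q v)"
  by (induct p arbitrary: u) auto

lemma dipath_not_all_arcs:
  assumes "oriented_cycle D" and "dipath D p"
  shows "set p \<noteq> parcs D"
proof
  assume all: "set p = parcs D"
  interpret oriented_graph D using assms(1) by (simp add: oriented_cycle_def)
  have mk: "parcs (mk_symmetric D) = parcs D \<union> (parcs D)\<inverse>" "pverts (mk_symmetric D) = pverts D"
    by (auto simp: mk_symmetric_def)
  obtain c where c: "pre_digraph.cycle (mk_symmetric D) c" "3 \<le> length c"
    "pverts D = fst ` set c" "parcs (mk_symmetric D) = set c \<union> (set c)\<inverse>"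
    using assms(1) mk by (auto simp: oriented_cycle_def is_cycle_graph_def)
  from c(1) obtain s where s: "pcas s c s" "distinct (tl (pawalk_verts s c))"
    by (auto simp: pre_digraph.cycle_def pre_digraph.awalk_def cas_with_proj_eq
        awalk_verts_with_proj_eq)
  have dc: "distinct (map snd c)" using pcas_verts(1)[OF s(1)] s(2) by simp
  from assms(2) obtain u v where p: "pcas u p v" "distinct (pawalk_verts u p)" "u \<in> pverts D"
    "set p \<subseteq> parcs D"
    by (auto simp: dipath_def pre_digraph.apath_def pre_digraph.awalk_def cas_with_proj_eq
        awalk_verts_with_proj_eq)
  have dp: "distinct (map snd p)" using p(2) pcas_verts(1)[OF p(1)] by simp
  have vp: "v \<notin> fst ` set p" using p(2) unfolding pcas_verts(2)[OF p(1)] by simp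
  have vin: "v \<in> pverts D"
  proof (cases p rule: rev_cases)
    case Nil then show ?thesis using p by simp
  next
    case (snoc p' e)
    then have "snd e = v" using p(1) by (auto simp: pcas_append)
    then show ?thesis using snoc p(4) arc_snd_in_verts by auto
  qed
  have uniq: "x = y" if "(v, x) \<in> parcs (mk_symmetric D)" "(v, y) \<in> parcs (mk_symmetric D)" for x y
  proof -
    have "(v, z) \<notin> set p" for z using vp by force
    then have "(x, v) \<in> set p" "(y, v) \<in> set p" using that mk all by auto
    then show ?thesis using dp inj_onD[of snd "set p" "(x, v)" "(y, v)"] by (simp add: distinct_map)
  qed
  obtain w where w: "(v, w) \<in> set c" using vin c(3) by auto
  have "insert s (snd ` set c) = insert s (fst ` set c)"
    using arg_cong[where f = set, OF pcas_verts(1)[OF s(1)]]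
      arg_cong[where f = set, OF pcas_verts(2)[OF s(1)]] by simp
  moreover have "s \<in> snd ` set c"
    using s(1) c(2) by (cases c rule: rev_cases) (auto simp: pcas_append)
  ultimately have "v \<in> snd ` set c" using vin c(3) by auto
  then obtain x where x: "(x, v) \<in> set c" by auto
  have "x = w" using w x c(4) by (intro uniq) auto
  with x have wv: "(w, v) \<in> set c" by simp
  have "w \<noteq> v" using w c(4) mk no_loops by fastforce
  obtain q r where qr: "c = q @ (v, w) # r" using w by (auto dest: split_list)
  define t where "t = r @ q"
  have "pcas s q v" "pcas w r s" using s(1)[unfolded qr pcas_append] by auto
  then have "pcas w t v" unfolding t_def pcas_append by blast
  moreover have "distinct (map snd ((v, w) # t))" "(w, v) \<in> set t" "length c = Suc (length t)"
    using dc wv \<open>w \<noteq> v\<close> by (auto simp: t_def qr)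
  ultimately have t: "pcas w t v" "distinct (map snd ((v, w) # t))" "(w, v) \<in> set t"
    "length c = Suc (length t)" .
  obtain b rest where rest: "t = (w, b) # rest" using t(1,3) by (cases t) auto
  have "w \<notin> set (pawalk_verts b rest)"
    using pcas_verts(1)[of b rest v] t(1,2) rest by auto
  then have "(w, v) \<notin> set rest" using pcas_verts(2)[of b rest v] t(1) rest by force
  then have "b = v" using t(3) rest by auto
  then have "pcas v rest v" using t(1) rest by simp
  have "rest = []"
  proof (cases rest rule: rev_cases)
    case (snoc r' e)
    then have "snd e = v" using \<open>pcas v rest v\<close> by (auto simp: pcas_append)
    then show ?thesis using t(2) rest snoc \<open>b = v\<close> by auto
  qed
  then show False using c(2) t(4) rest by simp
qed

lemma more_than_one_block_iff:
  assumes "oriented_cycle D"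
  shows "more_than_one_block D \<longleftrightarrow> \<not> directed_cycle D"
proof -
  interpret oriented_graph D using assms by (simp add: oriented_cycle_def)
  have fin: "finite (parcs D)" by (rule pair_finite_arcs)
  have sub: "set p \<subseteq> parcs D" if "dipath D p" for p
    using that by (auto simp: dipath_def pre_digraph.apath_def pre_digraph.awalk_def)
  have ext: "\<exists>p \<in> blocks D. e \<in> set p" if e: "e \<in> parcs D" for e
  proof -
    have "dipath D [e]" unfolding dipath_def apath_def awalk_def
      using e no_loops[OF e] arc_fst_in_verts[OF e] by auto
    then have "dipath D [e] \<and> e \<in> set [e]" by simp
    moreover have "\<forall>p. dipath D p \<and> e \<in> set p \<longrightarrow> card (set p) < Suc (card (parcs D))"
      using sub fin by (simp add: card_mono less_Suc_eq_le)
    ultimately obtain p where p: "dipath D p" "e \<in> set p"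
      "\<And>q. dipath D q \<Longrightarrow> e \<in> set q \<Longrightarrow> card (set q) \<le> card (set p)"
      using ex_has_greatest_nat[of "\<lambda>p. dipath D p \<and> e \<in> set p" "[e]" "\<lambda>p. card (set p)"] by blast
    have "\<not> set p \<subset> set q" if "dipath D q" for q
      using p that psubset_card_mono[of "set q" "set p"] by fastforce
    then show ?thesis using p by (auto simp: blocks_def)
  qed
  have "blocks D \<subseteq> (fst \<circ> snd) ` {(u, p, v). apath u p v}"
    by (force simp: blocks_def dipath_def)
  then have finb: "finite (blocks D)"
    using apaths_finite_triple by (meson finite_imageI finite_subset)
  have proper: "\<exists>e \<in> parcs D. e \<notin> set p" if "p \<in> blocks D" for p
    using that dipath_not_all_arcs[OF assms, of p] sub[of p] by (auto simp: blocks_def)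
  have "parcs D \<noteq> {}"
    using assms
    by (auto simp: oriented_cycle_def is_cycle_graph_def mk_symmetric_def)
  then obtain p q where "p \<in> blocks D" "q \<in> blocks D" "p \<noteq> q"
    using ext proper by (metis ex_in_conv)
  then have "1 < card (blocks D)"
    using finb by (metis One_nat_def card_le_Suc0_iff_eq not_less)
  then show ?thesis by (simp add: more_than_one_block_def)
qed

text \<open>
  \<^term>\<open>f\<close> embeds the vertices of \<^term>\<open>F\<close> as branch vertices of \<^term>\<open>S\<close>, and \<^term>\<open>P e\<close> is the
  directed path replacing the arc \<^term>\<open>e\<close>. The library predicate \<^const>\<open>pre_digraph.gen_iapath\<close>
  says that this is a nonempty path between branch vertices with no branch vertex inside.
\<close>

definition is_subdivision_of :: "'a pair_pre_digraph \<Rightarrow> 'b pair_pre_digraph \<Rightarrow> bool" where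
  "is_subdivision_of S F \<longleftrightarrow>
     (\<exists>(f :: 'b \<Rightarrow> 'a) (P :: 'b \<times> 'b \<Rightarrow> ('a \<times> 'a) list).
        inj_on f (pverts F) \<and>
        (\<forall>(x, y) \<in> parcs F. pre_digraph.gen_iapath S (f ` pverts F) (f x) (P (x, y)) (f y)) \<and>
        (\<forall>e \<in> parcs F. \<forall>e' \<in> parcs F. e \<noteq> e' \<longrightarrow>
           set (pre_digraph.inner_verts S (P e)) \<inter> set (pre_digraph.inner_verts S (P e')) = {}) \<and>
        pverts S = f ` pverts F \<union> (\<Union>e \<in> parcs F. set (pre_digraph.inner_verts S (P e))) \<and>
        parcs S = (\<Union>e \<in> parcs F. set (P e)))"

definition contains_subdivision :: "'a pair_pre_digraph \<Rightarrow> 'b pair_pre_digraph \<Rightarrow> bool" where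
  "contains_subdivision D F \<longleftrightarrow>
     (\<exists>S :: 'a pair_pre_digraph. subgraph (with_proj S) (with_proj D) \<and> is_subdivision_of S F)"

end

theory Submission
  imports Defs
begin

text \<open>
  Number the vertices of \<open>H\<close> along the Hamiltonian path. A rainbow is a set of pairwise nested edges
  \<open>u\<^sub>1 < u\<^sub>2 < \<dots> < u\<^sub>n < v\<^sub>n < \<dots> < v\<^sub>2 < v\<^sub>1\<close>; suppose that a further edge \<open>x y\<close> crosses it, that is,
  \<open>u\<^sub>n < x < v\<^sub>n\<close> and \<open>v\<^sub>1 \<le> y\<close>. The directions of all these edges are arbitrary.

  Such a crossed rainbow of \<open>n\<close> edges contains a subdivision of each cycle of order \<open>n\<close> that is not
  directed. The segments of the path through the \<open>u\<^sub>i\<close> and through the \<open>v\<^sub>i\<close> are the rails of a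
  ladder. A walk that moves inwards on the first rail follows the arcs of the path, and on
  the second rail it goes against them. Start at \<open>y\<close> and read the cycle arc by arc, beginning with a
  backward arc that follows a forward one. Each arc takes the walk from one rung to the next on the
  rail of the right direction. A change of rails uses a rung, whose own direction prolongs either the
  block before or the block after the turn. After \<open>n\<close> arcs the walk is at \<open>x\<close>, and the edge \<open>x y\<close>
  closes it. This is \<open>ex_cycle_spelling\<close>, and \<open>contains_subdivision_of_cycle_word\<close>
  turns the closed walk into a subdivision.

  It remains to find a crossed rainbow. Since the chromatic number is large, some set of vertices
  induces a subgraph of large minimum degree, so it is enough to bound the number of edges of an
  ordered graph without a crossed rainbow of \<open>K\<close> edges linearly, with a constant of order \<open>K\<close>
  (\<open>card_edges_of_uncrossed\<close>). The proof cuts the graph at an edge \<open>x z\<close>, where \<open>z\<close> is the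
  last vertex. The edges that pass over \<open>x\<close> and end before \<open>z\<close> contain no rainbow of \<open>K\<close> edges, since
  \<open>x z\<close> would cross it. Hence they fall into \<open>K - 1\<close> classes according to the length of the
  longest chain of nested edges that starts at them. In the graph on one side of the cut, all vertices
  of the other side are merged into one vertex for each class. Edges in one class are not nested,
  and therefore the two compressed graphs together have at least as many edges as the original graph,
  while the number of vertices grows only by \<open>2 * K\<close>. The point is that no crossed rainbow arises: a
  sequence of compressed edges whose heights decrease inwards can be exchanged for nested original
  edges with ends in the same range (\<open>chain_of_decreasing_heights\<close>).

  The resulting bound shows that a chromatic number larger than \<open>9 * n - 3\<close> suffices, and
  \<open>12 * n - 5\<close> is larger for every positive \<open>n\<close>.
\<close>

section \<open>Chains and crossed rainbows\<close>

definition nested :: "real \<times> real \<Rightarrow> real \<times> real \<Rightarrow> bool" where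
  "nested e e' \<longleftrightarrow> fst e < fst e' \<and> snd e' < snd e"

text \<open>
  Vertices are real numbers, so that new ones can be put between old ones. An edge is a pair with the
  smaller vertex first, and a rainbow is listed from its outermost edge
  inwards. The inequality at \<open>y\<close> is weak on purpose: the replacement of compressed edges by
  original ones in \<open>left_part_not_crossed\<close> below controls the upper end of the crossing
  edge only up to equality.
\<close>

definition crossed_rainbow :: "nat \<Rightarrow> (real \<times> real) set \<Rightarrow> bool" where
  "crossed_rainbow K E \<longleftrightarrow>
     (\<exists>es x y. length es = K \<and> set es \<subseteq> E \<and> sorted_wrt nested es \<and> (x, y) \<in> E \<and>
        (\<forall>e \<in> set es. fst e < x \<and> x < snd e \<and> snd e \<le> y))"

lemma crossed_rainbowI:
  assumes "length es = K" "set es \<subseteq> E" "sorted_wrt nested es" "(x, y) \<in> E"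
    and "\<And>e. e \<in> set es \<Longrightarrow> fst e < x \<and> x < snd e \<and> snd e \<le> y"
  shows "crossed_rainbow K E"
  using assms unfolding crossed_rainbow_def by blast

lemma crossed_rainbow_mono: "crossed_rainbow K E \<Longrightarrow> E \<subseteq> E' \<Longrightarrow> crossed_rainbow K E'"
  unfolding crossed_rainbow_def by blast

text \<open>
  The height of an element is the largest number of elements that can follow it in a chain. Besides being
  strictly monotone, it takes all values below \<open>\<rho> e\<close> along a chain that starts at \<open>e\<close>.
\<close>

lemma ex_chain_height:
  assumes fin: "finite A" and R: "transp R" "irreflp R"
  obtains \<rho> :: "'a \<Rightarrow> nat" where
    "\<And>e c. e \<in> A \<Longrightarrow> c \<in> A \<Longrightarrow> R e c \<Longrightarrow> \<rho> c < \<rho> e"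
    "\<And>e m. e \<in> A \<Longrightarrow> \<rho> e = Suc m \<Longrightarrow> \<exists>c \<in> A. R e c \<and> \<rho> c = m"
    "\<And>e. e \<in> A \<Longrightarrow> \<exists>es. length es = Suc (\<rho> e) \<and> set es \<subseteq> A \<and> sorted_wrt R es"
proof -
  define S where "S e = {es. set es \<subseteq> A \<and> sorted_wrt R (e # es)}" for e
  define \<rho> where "\<rho> e = Max (length ` S e)" for e
  have dist: "distinct es" if "sorted_wrt R es" for es
    using that R(2) by (induct es) (auto simp: irreflp_def)
  have finS: "finite (S e)" for e
    using finite_subset[OF _ finite_subset_distinct[OF fin], of "S e"] dist
    by (auto simp: S_def)
  have Nil: "[] \<in> S e" for e by (simp add: S_def)
  have le: "length es \<le> \<rho> e" if "es \<in> S e" for es e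
    unfolding \<rho>_def using that finS by (intro Max_ge) auto
  have att: "\<exists>es \<in> S e. length es = \<rho> e" for e
  proof -
    have "\<rho> e \<in> length ` S e" unfolding \<rho>_def using finS Nil by (intro Max_in) auto
    then show ?thesis by auto
  qed
  have mono: "\<rho> c < \<rho> e" if "c \<in> A" "R e c" for e c
  proof -
    obtain es where es: "es \<in> S c" "length es = \<rho> c" using att by blast
    have "c # es \<in> S e" using es(1) that R(1) by (auto simp: S_def dest: transpD)
    then show ?thesis using le es(2) by fastforce
  qed
  have step: "\<exists>c \<in> A. R e c \<and> \<rho> c = m" if Suc: "\<rho> e = Suc m" for e m
  proof -
    obtain es where es: "es \<in> S e" "length es = \<rho> e" using att by blast
    then obtain c es' where c: "es = c # es'" using Suc by (cases es) auto
    then have *: "c \<in> A" "R e c" "es' \<in> S c" using es by (auto simp: S_def)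
    then have "m \<le> \<rho> c" using le es(2) that c by fastforce
    moreover have "\<rho> c < \<rho> e" using mono * by blast
    ultimately show ?thesis using * that by force
  qed
  have "\<exists>es. length es = Suc (\<rho> e) \<and> set es \<subseteq> A \<and> sorted_wrt R es" if "e \<in> A" for e
  proof -
    obtain es where es: "es \<in> S e" "length es = \<rho> e" using att by blast
    then show ?thesis using that by (intro exI[of _ "e # es"]) (auto simp: S_def)
  qed
  with mono step show thesis by (intro that[of \<rho>])
qed

text \<open>
  The exchange argument behind the compression of edges. The order is the strict product order of
  two coordinates \<open>f\<close> and \<open>g\<close>, and only the first coordinate and the height of the given elements
  are compatible with a chain. If two consecutive elements \<open>e\<close>, \<open>d\<close> fail in the second coordinate,
  take the successor \<open>c\<close> of \<open>e\<close> whose height is one less. Its first coordinate cannot exceed that of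
  \<open>d\<close>, since otherwise \<open>c\<close> would lie above \<open>d\<close> and \<open>d\<close> would have the larger height; so \<open>c\<close> can
  take the place of \<open>d\<close>. The bound on the first coordinates keeps the new chain inside the range of
  the old sequence, and this is what allows it to be combined with edges elsewhere.
\<close>

lemma chain_of_decreasing_heights:
  fixes f g :: "'a \<Rightarrow> 'b :: linorder" and \<rho> :: "'a \<Rightarrow> nat"
  assumes mono: "\<And>e c. e \<in> A \<Longrightarrow> c \<in> A \<Longrightarrow> f e < f c \<Longrightarrow> g e < g c \<Longrightarrow> \<rho> c < \<rho> e"
    and step: "\<And>e m. e \<in> A \<Longrightarrow> \<rho> e = Suc m \<Longrightarrow> \<exists>c \<in> A. f e < f c \<and> g e < g c \<and> \<rho> c = m"
    and "set (e # es) \<subseteq> A" "sorted_wrt (\<lambda>e e'. f e < f e' \<and> \<rho> e' < \<rho> e) (e # es)"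
  shows "\<exists>es'. length es' = length es \<and> set es' \<subseteq> A \<and>
           sorted_wrt (\<lambda>e e'. f e < f e' \<and> g e < g e') (e # es') \<and>
           (\<forall>c \<in> set es'. f c \<le> f (last (e # es)))"
  using assms(3,4)
proof (induct es arbitrary: e)
  case Nil
  then show ?case by simp
next
  case (Cons d es)
  have "\<exists>c \<in> A. f e < f c \<and> g e < g c \<and> f c \<le> f d \<and> \<rho> d \<le> \<rho> c"
  proof (cases "g e < g d")
    case True
    then show ?thesis using Cons.prems by auto
  next
    case False
    obtain m where m: "\<rho> e = Suc m" using Cons.prems(2) by (cases "\<rho> e") auto
    obtain c where c: "c \<in> A" "f e < f c" "g e < g c" "\<rho> c = m"
      using step[OF _ m] Cons.prems(1) by auto
    have md: "\<rho> d \<le> m" using m Cons.prems(2) by simp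
    have "\<not> f d < f c"
      using mono[of d c] c False md Cons.prems(1) by fastforce
    then show ?thesis using c md by (intro bexI[of _ c]) auto
  qed
  then obtain c where c: "c \<in> A" "f e < f c" "g e < g c" "f c \<le> f d" "\<rho> d \<le> \<rho> c" by blast
  have "sorted_wrt (\<lambda>e e'. f e < f e' \<and> \<rho> e' < \<rho> e) (c # es)"
    using Cons.prems(2) c(4,5) by (fastforce intro: le_less_trans less_le_trans)
  then obtain es' where es': "length es' = length es" "set es' \<subseteq> A"
    "sorted_wrt (\<lambda>e e'. f e < f e' \<and> g e < g e') (c # es')"
    "\<forall>b \<in> set es'. f b \<le> f (last (c # es))"
    using Cons.hyps[of c] Cons.prems(1) c(1) by auto
  have "f c \<le> f (last (d # es))" and "f (last (c # es)) \<le> f (last (d # es))"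
    using c(4) Cons.prems(2) by (auto intro!: less_imp_le[OF le_less_trans[OF c(4)]])
  then show ?case
    using es' c by (intro exI[of _ "c # es'"]) (fastforce intro: less_trans)
qed

section \<open>Cutting an ordered graph at an edge\<close>

text \<open>
  The vertices are cut at an edge \<open>(x, z)\<close> whose upper end is the last vertex. The edges in \<open>A\<close>
  run from below \<open>x\<close> into the open interval between \<open>x\<close> and \<open>z\<close>; they contain \<open>x\<close> and end before \<open>z\<close>, so
  \<open>(x, z)\<close> crosses each rainbow in \<open>A\<close> and the heights in \<open>A\<close> are below \<open>K - 1\<close>.

  In the right part all vertices below \<open>x\<close> are replaced by one vertex \<open>\<eta> r\<close> for each height \<open>r\<close>, and
  in the left part all vertices strictly between \<open>x\<close> and \<open>z\<close> by one vertex \<open>\<xi> r\<close> for each height.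
  Inner edges have smaller height, hence \<open>\<eta>\<close> decreases and \<open>\<xi>\<close> increases: in a rainbow of compressed
  edges the heights then decrease inwards.
\<close>

locale split_at_edge =
  fixes K :: nat and E :: "(real \<times> real) set" and x z :: real
    and A :: "(real \<times> real) set" and \<rho> :: "real \<times> real \<Rightarrow> nat" and \<eta> \<xi> :: "nat \<Rightarrow> real"
  assumes finE: "finite E" and K: "0 < K" and no_crossing: "\<not> crossed_rainbow K E"
    and edge: "(x, z) \<in> E" and above: "\<And>e. e \<in> E \<Longrightarrow> snd e \<le> z" and up: "\<And>e. e \<in> E \<Longrightarrow> fst e < snd e"
    and A_eq: "A = {e \<in> E. fst e < x \<and> x < snd e \<and> snd e < z}"
    and height_mono: "\<And>e c. e \<in> A \<Longrightarrow> c \<in> A \<Longrightarrow> nested e c \<Longrightarrow> \<rho> c < \<rho> e"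
    and height_step: "\<And>e m. e \<in> A \<Longrightarrow> \<rho> e = Suc m \<Longrightarrow> \<exists>c \<in> A. nested e c \<and> \<rho> c = m"
    and height_bound: "\<And>e. e \<in> A \<Longrightarrow> Suc (\<rho> e) < K"
    and eta: "strict_antimono_on UNIV \<eta>" "\<And>r. \<eta> r < x"
    and xi: "strict_mono_on {r. Suc r < K} \<xi>" "\<And>r. Suc r < K \<Longrightarrow> x < \<xi> r \<and> \<xi> r < z"
begin

definition right_part :: "(real \<times> real) set" where
  "right_part = {e \<in> E. x \<le> fst e} \<union> (\<lambda>e. (\<eta> (\<rho> e), snd e)) ` A"

definition left_part :: "(real \<times> real) set" where
  "left_part = {e \<in> E. fst e \<le> x \<and> (snd e \<le> x \<or> snd e = z)} \<union> (\<lambda>e. (fst e, \<xi> (\<rho> e))) ` A"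

lemma A_sub: "A \<subseteq> E" by (auto simp: A_eq)

lemma chain_length: "length es < K" if "set es \<subseteq> A" "sorted_wrt nested es"
proof (rule ccontr)
  assume "\<not> length es < K"
  then have "length (take K es) = K" "set (take K es) \<subseteq> A" "sorted_wrt nested (take K es)"
    using that set_take_subset[of K es] by (auto simp: sorted_wrt_take)
  then have "crossed_rainbow K E"
    using edge A_sub by (intro crossed_rainbowI[of "take K es" K E x z]) (auto simp: A_eq)
  then show False using no_crossing by simp
qed

text \<open>
  The compressed edges of a rainbow are its outermost ones. Their upper ends and heights form a
  sequence as in \<open>chain_of_decreasing_heights\<close>, which yields a rainbow in \<open>A\<close> with upper
  ends in the same range. The crossing edge itself is not compressed: otherwise all \<open>K\<close> edges of
  the rainbow would be, which is one more than the length of a chain in \<open>A\<close> allows.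
\<close>

lemma right_part_not_crossed: "\<not> crossed_rainbow K right_part"
proof
  assume "crossed_rainbow K right_part"
  then obtain es a b where es: "length es = K" "set es \<subseteq> right_part" "sorted_wrt nested es"
    and ab: "(a, b) \<in> right_part" and cross: "\<And>e. e \<in> set es \<Longrightarrow> fst e < a \<and> a < snd e \<and> snd e \<le> b"
    unfolding crossed_rainbow_def by blast
  define es1 es2 where "es1 = takeWhile (\<lambda>e. fst e < x) es" and "es2 = dropWhile (\<lambda>e. fst e < x) es"
  have app: "es = es1 @ es2" by (simp add: es1_def es2_def)
  have s: "sorted_wrt nested es1" "sorted_wrt nested es2"
    "\<And>e e'. e \<in> set es1 \<Longrightarrow> e' \<in> set es2 \<Longrightarrow> nested e e'"
    using es(3) unfolding app sorted_wrt_append by auto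
  have es1: "fst e < x" if "e \<in> set es1" for e using that set_takeWhileD unfolding es1_def by fast
  have es2: "x \<le> fst e" if "e \<in> set es2" for e
  proof (cases es2)
    case (Cons d ds)
    then have "\<not> fst d < x" unfolding es2_def by (simp add: dropWhile_eq_Cons_conv)
    then show ?thesis using that s(2) Cons by (auto simp: nested_def)
  qed (use that in simp)
  have es2E: "set es2 \<subseteq> E"
    using es(2) es2 eta(2) unfolding app right_part_def by (force simp: not_less[symmetric])
  show False
  proof (cases es1)
    case Nil
    then have "es2 \<noteq> []" using es(1) K app by auto
    then have "x < a" using es2[of "hd es2"] cross[of "hd es2"] app by force
    then have "(a, b) \<in> E" using ab eta(2) unfolding right_part_def by (force dest: less_asym)
    then have "crossed_rainbow K E"
      using es es2E Nil app cross by (intro crossed_rainbowI[of es K E a b]) auto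
    then show False using no_crossing by simp
  next
    case (Cons e0 es0)
    have "\<forall>e \<in> set es1. \<exists>c \<in> A. e = (\<eta> (\<rho> c), snd c)"
      using es(2) es1 unfolding app right_part_def by fastforce
    then obtain h where h: "\<And>e. e \<in> set es1 \<Longrightarrow> h e \<in> A \<and> e = (\<eta> (\<rho> (h e)), snd (h e))" by metis
    have anti: "\<rho> c' < \<rho> c" if "\<eta> (\<rho> c) < \<eta> (\<rho> c')" for c c'
    proof (rule ccontr)
      assume "\<not> \<rho> c' < \<rho> c"
      then have "\<rho> c = \<rho> c' \<or> \<rho> c < \<rho> c'" by auto
      then show False using that eta(1) by (auto simp: monotone_on_def dest: less_asym)
    qed
    have rel: "- snd (h e) < - snd (h e') \<and> \<rho> (h e') < \<rho> (h e)"
      if "e \<in> set es1" "e' \<in> set es1" "nested e e'" for e e'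
      using that h[of e] h[of e'] anti unfolding nested_def by (metis fst_conv snd_conv neg_less_iff_less)
    have "sorted_wrt (\<lambda>c c'. - snd c < - snd c' \<and> \<rho> c' < \<rho> c) (map h es1)"
      unfolding sorted_wrt_map by (rule sorted_wrt_mono_rel[OF _ s(1)]) (rule rel)
    moreover have "set (map h es1) \<subseteq> A" using h by auto
    ultimately have "\<exists>cs. length cs = length (map h es0) \<and> set cs \<subseteq> A \<and>
      sorted_wrt (\<lambda>c c'. - snd c < - snd c' \<and> fst c < fst c') (h e0 # cs) \<and>
      (\<forall>c \<in> set cs. - snd c \<le> - snd (last (h e0 # map h es0)))"
      using height_mono height_step unfolding Cons list.map nested_def
      by (intro chain_of_decreasing_heights[of A "\<lambda>c. - snd c" fst \<rho>]) (simp, metis neg_less_iff_less)+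
    then obtain cs where cs: "length cs = length (map h es0)" "set cs \<subseteq> A"
      "sorted_wrt (\<lambda>c c'. - snd c < - snd c' \<and> fst c < fst c') (h e0 # cs)"
      "\<forall>c \<in> set cs. - snd c \<le> - snd (last (map h es1))"
      unfolding Cons list.map by blast
    have csA: "set (h e0 # cs) \<subseteq> A" using cs(2) h Cons by auto
    have csn: "sorted_wrt nested (h e0 # cs)"
      using cs(3) by (rule sorted_wrt_mono_rel[rotated]) (auto simp: nested_def)
    have last1: "last es1 \<in> set es1" using Cons by simp
    have snd_last: "snd (last es1) = snd (last (map h es1))"
      using h[OF last1] Cons by (metis last_map list.distinct(1) snd_conv)
    have low: "snd (last es1) \<le> snd c" if "c \<in> set (h e0 # cs)" for c
    proof (cases "c = h e0")
      case True
      have "snd (last es1) \<le> snd e0" using s(1) unfolding Cons by (auto simp: nested_def less_imp_le)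
      then show ?thesis using True h[of e0] Cons by (metis list.set_intros(1) snd_conv)
    next
      case False
      then show ?thesis using that cs(4) snd_last by auto
    qed
    have high: "snd c \<le> b" if "c \<in> set (h e0 # cs)" for c
    proof -
      have "snd c \<le> snd (h e0)" using that csn by (auto simp: nested_def)
      also have "\<dots> = snd e0" using h[of e0] Cons by (metis list.set_intros(1) snd_conv)
      also have "\<dots> \<le> b" using cross[of e0] app Cons by auto
      finally show ?thesis .
    qed
    have len: "length (h e0 # cs) = length es1" using cs(1) Cons by simp
    have abE: "(a, b) \<in> E" "x \<le> a"
    proof -
      have "x \<le> a"
      proof (rule ccontr)
        assume "\<not> x \<le> a"
        then have "es2 = []" using es2[of "hd es2"] cross[of "hd es2"] app by (cases es2) auto
        then show False using chain_length[OF csA csn] len es(1) app by simp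
      qed
      then show "(a, b) \<in> E" "x \<le> a" using ab eta(2) unfolding right_part_def
        by (force simp: not_less[symmetric])+
    qed
    let ?ds = "(h e0 # cs) @ es2"
    have "nested c e" if "c \<in> set (h e0 # cs)" "e \<in> set es2" for c e
      using that csA es2[of e] s(3)[OF last1, of e] low[of c] by (force simp: nested_def A_eq)
    then have "sorted_wrt nested ?ds"
      unfolding sorted_wrt_append using csn s(2) by blast
    moreover have "length ?ds = K" using len es(1) app by simp
    moreover have "set ?ds \<subseteq> E" using csA A_sub es2E by auto
    moreover have "\<forall>e \<in> set ?ds. fst e < a \<and> a < snd e \<and> snd e \<le> b"
    proof
      fix e assume "e \<in> set ?ds"
      then consider "e \<in> set es2" | "e \<in> set (h e0 # cs)" by auto
      then show "fst e < a \<and> a < snd e \<and> snd e \<le> b"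
      proof cases
        case 1
        then show ?thesis using cross app by auto
      next
        case 2
        then have "fst e < x" using csA by (auto simp: A_eq)
        moreover have "a < snd (last es1)" using cross[of "last es1"] last1 app by auto
        ultimately show ?thesis using low[OF 2] high[OF 2] abE(2) by auto
      qed
    qed
    ultimately have "crossed_rainbow K E"
      using abE(1) by (intro crossed_rainbowI[of ?ds K E a b]) blast+
    then show False using no_crossing by simp
  qed
qed

text \<open>
  Here the rainbow consists of at most one edge up to \<open>z\<close>, then compressed edges, then edges below
  \<open>x\<close>. The compressed edges are replaced by a rainbow in \<open>A\<close> that begins with a chosen original
  \<open>h d\<close> of the outermost of them. If the crossing edge is compressed as well, any original \<open>c\<close> of it
  crosses the new rainbow: its height is at least that of \<open>h d\<close> and its lower end is larger, so it
  is not inside \<open>h d\<close> and its upper end is not below that of \<open>h d\<close>.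
\<close>

lemma left_part_not_crossed: "\<not> crossed_rainbow K left_part"
proof
  assume "crossed_rainbow K left_part"
  then obtain es a b where es: "length es = K" "set es \<subseteq> left_part" "sorted_wrt nested es"
    and ab: "(a, b) \<in> left_part" and cross: "\<And>e. e \<in> set es \<Longrightarrow> fst e < a \<and> a < snd e \<and> snd e \<le> b"
    unfolding crossed_rainbow_def by blast
  have xi_A: "x < \<xi> (\<rho> c)" "\<xi> (\<rho> c) < z" if "c \<in> A" for c
    using xi(2) height_bound that by auto
  define es0 es1 es2 where "es0 = takeWhile (\<lambda>e. z \<le> snd e) es"
    and "es1 = takeWhile (\<lambda>e. x < snd e) (dropWhile (\<lambda>e. z \<le> snd e) es)"
    and "es2 = dropWhile (\<lambda>e. x < snd e) (dropWhile (\<lambda>e. z \<le> snd e) es)"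
  have app: "es = es0 @ es1 @ es2" by (simp add: es0_def es1_def es2_def)
  have s: "sorted_wrt nested es0" "sorted_wrt nested es1" "sorted_wrt nested es2"
    "\<And>e e'. e \<in> set es0 \<Longrightarrow> e' \<in> set es1 \<Longrightarrow> nested e e'"
    "\<And>e e'. e \<in> set es0 \<Longrightarrow> e' \<in> set es2 \<Longrightarrow> nested e e'"
    "\<And>e e'. e \<in> set es1 \<Longrightarrow> e' \<in> set es2 \<Longrightarrow> nested e e'"
    using es(3) unfolding app sorted_wrt_append by auto
  have head: "snd e \<le> snd (hd xs)" if "sorted_wrt nested xs" "e \<in> set xs" for e xs
    using that by (cases xs) (auto simp: nested_def)
  have es0: "z \<le> snd e" if "e \<in> set es0" for e using that set_takeWhileD unfolding es0_def by fast
  have es1: "x < snd e \<and> snd e < z" if "e \<in> set es1" for e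
  proof -
    have "e \<in> set (dropWhile (\<lambda>e. z \<le> snd e) es)" using that set_takeWhileD unfolding es1_def by fast
    moreover have "sorted_wrt nested (dropWhile (\<lambda>e. z \<le> snd e) es)"
      using es(3) by (simp add: sorted_wrt_dropWhile)
    moreover have "dropWhile (\<lambda>e. z \<le> snd e) es \<noteq> [] \<Longrightarrow> \<not> z \<le> snd (hd (dropWhile (\<lambda>e. z \<le> snd e) es))"
      by (rule hd_dropWhile) (auto simp: dropWhile_eq_Nil_conv)
    ultimately have "snd e < z" using head by fastforce
    then show ?thesis using that set_takeWhileD unfolding es1_def by fast
  qed
  have es2: "snd e \<le> x" if "e \<in> set es2" for e
  proof -
    have "es2 \<noteq> []" using that by auto
    then have "\<not> x < snd (hd es2)" unfolding es2_def using hd_dropWhile[of "\<lambda>e. x < snd e"] by blast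
    then show ?thesis using head[OF s(3) that] by simp
  qed
  have outer: "e \<in> E" if "e \<in> left_part" "snd e \<le> x \<or> z \<le> snd e" for e
    using that xi_A unfolding left_part_def by (auto simp: not_less[symmetric])
  have es0E: "set es0 \<subseteq> E" and es2E: "set es2 \<subseteq> E"
    using es(2) es0 es2 outer unfolding app by auto
  show False
  proof (cases es1)
    case Nil
    show False
    proof (cases "(a, b) \<in> E")
      case True
      then have "crossed_rainbow K E"
        using es es0E es2E Nil app cross by (intro crossed_rainbowI[of es K E a b]) auto
      then show False using no_crossing by simp
    next
      case False
      then obtain c where c: "c \<in> A" "a = fst c" "b = \<xi> (\<rho> c)" using ab by (auto simp: left_part_def)
      then have "es0 = []" using xi_A[OF c(1)] es0[of "hd es0"] cross[of "hd es0"] app by (cases es0) auto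
      then have "crossed_rainbow K E"
        using es es2E es2 Nil app cross c A_sub
        by (intro crossed_rainbowI[of es K E a "snd c"]) (force simp: A_eq)+
      then show False using no_crossing by simp
    qed
  next
    case (Cons d ds)
    have "\<forall>e \<in> set es1. \<exists>c \<in> A. e = (fst c, \<xi> (\<rho> c))"
      using es(2) es1 unfolding app left_part_def by fastforce
    then obtain h where h: "\<And>e. e \<in> set es1 \<Longrightarrow> h e \<in> A \<and> e = (fst (h e), \<xi> (\<rho> (h e)))" by metis
    have xi_le: "\<rho> c \<le> \<rho> c'" if "\<xi> (\<rho> c) \<le> \<xi> (\<rho> c')" "c \<in> A" "c' \<in> A" for c c'
      using that xi(1) height_bound by (metis (mono_tags) linorder_not_less mem_Collect_eq monotone_on_def)
    have xi_less: "\<rho> c < \<rho> c'" if "\<xi> (\<rho> c) < \<xi> (\<rho> c')" "c \<in> A" "c' \<in> A" for c c'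
      using that xi_le[of c' c] xi_le[of c c'] by (metis le_neq_implies_less less_irrefl less_imp_le)
    have rel: "fst (h e) < fst (h e') \<and> \<rho> (h e') < \<rho> (h e)"
      if "e \<in> set es1" "e' \<in> set es1" "nested e e'" for e e'
      using that h[of e] h[of e'] xi_less unfolding nested_def by (metis fst_conv snd_conv)
    have "sorted_wrt (\<lambda>c c'. fst c < fst c' \<and> \<rho> c' < \<rho> c) (map h es1)"
      unfolding sorted_wrt_map by (rule sorted_wrt_mono_rel[OF _ s(2)]) (rule rel)
    moreover have "set (map h es1) \<subseteq> A" using h by auto
    ultimately have "\<exists>cs. length cs = length (map h ds) \<and> set cs \<subseteq> A \<and>
      sorted_wrt (\<lambda>c c'. fst c < fst c' \<and> - snd c < - snd c') (h d # cs) \<and>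
      (\<forall>c \<in> set cs. fst c \<le> fst (last (h d # map h ds)))"
      using height_mono height_step unfolding Cons list.map nested_def
      by (intro chain_of_decreasing_heights[of A fst "\<lambda>c. - snd c" \<rho>]) (simp, metis neg_less_iff_less)+
    then obtain cs where cs: "length cs = length (map h ds)" "set cs \<subseteq> A"
      "sorted_wrt (\<lambda>c c'. fst c < fst c' \<and> - snd c < - snd c') (h d # cs)"
      "\<forall>c \<in> set cs. fst c \<le> fst (last (map h es1))"
      unfolding Cons list.map by blast
    have csA: "set (h d # cs) \<subseteq> A" using cs(2) h Cons by auto
    have csn: "sorted_wrt nested (h d # cs)"
      using cs(3) by (rule sorted_wrt_mono_rel[rotated]) (auto simp: nested_def)
    have last1: "last es1 \<in> set es1" and d1: "d \<in> set es1" using Cons by auto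
    have fst_last: "fst (last es1) = fst (last (map h es1))"
      using h[OF last1] Cons by (metis last_map list.distinct(1) fst_conv)
    have fst_d: "fst (h d) = fst d" using h[OF d1] by (metis fst_conv)
    have high: "fst c \<le> fst (last es1)" if "c \<in> set (h d # cs)" for c
    proof (cases "c = h d")
      case True
      have "fst d \<le> fst (last es1)" using s(2) unfolding Cons by (auto simp: nested_def less_imp_le)
      then show ?thesis using True fst_d by simp
    next
      case False
      then show ?thesis using that cs(4) fst_last by auto
    qed
    have top: "fst d \<le> fst c \<and> snd c \<le> snd (h d)" if "c \<in> set (h d # cs)" for c
      using that csn fst_d by (auto simp: nested_def)
    have len: "length (h d # cs) = length es1" using cs(1) Cons by simp
    let ?ds = "es0 @ (h d # cs) @ es2"
    have n0: "nested e c" if "c \<in> set (h d # cs)" "e \<in> set es0" for c e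
      using that csA es0[of e] s(4)[of e d] d1 top[of c] by (force simp: nested_def A_eq)
    have n2: "nested c e" if "c \<in> set (h d # cs)" "e \<in> set es2" for c e
      using that csA es2[of e] s(6)[OF last1, of e] high[of c] by (force simp: nested_def A_eq)
    have "sorted_wrt nested ?ds"
      unfolding sorted_wrt_append using csn s n0 n2 by auto
    moreover have "length ?ds = K" using len es(1) app by simp
    moreover have "set ?ds \<subseteq> E" using csA A_sub es0E es2E by auto
    moreover have "\<exists>b'. (a, b') \<in> E \<and> (\<forall>e \<in> set ?ds. fst e < a \<and> a < snd e \<and> snd e \<le> b')"
    proof -
      have a_mid: "fst c < a" if "c \<in> set (h d # cs)" for c
        using high[OF that] cross[of "last es1"] last1 app by auto
      show ?thesis
      proof (cases "\<exists>c \<in> A. (a, b) = (fst c, \<xi> (\<rho> c))")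
        case True
        then obtain c where c: "c \<in> A" "a = fst c" "b = \<xi> (\<rho> c)" by auto
        have "es0 = []" using xi_A[OF c(1)] c es0[of "hd es0"] cross[of "hd es0"] app by (cases es0) auto
        have "snd d \<le> b" using cross[of d] d1 app by auto
        then have "\<rho> (h d) \<le> \<rho> c" using xi_le[of "h d" c] h[OF d1] c by (metis snd_conv)
        moreover have "fst (h d) < fst c" using a_mid[of "h d"] c by simp
        ultimately have "snd (h d) \<le> snd c"
          using height_mono[of "h d" c] c(1) csA by (force simp: nested_def)
        moreover have "fst c < x" "x < snd c" using c(1) by (auto simp: A_eq)
        ultimately have "fst e < a \<and> a < snd e \<and> snd e \<le> snd c" if "e \<in> set ?ds" for e
        proof (cases "e \<in> set (h d # cs)")
          case True
          then have "x < snd e" using csA by (auto simp: A_eq)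
          then show ?thesis using a_mid[OF True] top[OF True] c(2) \<open>fst c < x\<close> \<open>snd (h d) \<le> snd c\<close> by linarith
        next
          case False
          then have "e \<in> set es2" using that \<open>es0 = []\<close> by auto
          then show ?thesis using cross[of e] es2[of e] app \<open>x < snd c\<close> by auto
        qed
        then show ?thesis using c A_sub by (intro exI[of _ "snd c"]) auto
      next
        case False
        then have abE: "(a, b) \<in> E" "a \<le> x" "b \<le> x \<or> b = z" using ab by (auto simp: left_part_def)
        moreover have "x < b" using cross[of d] es1[OF d1] d1 app by auto
        ultimately have "b = z" by auto
        have "fst e < a \<and> a < snd e \<and> snd e \<le> b" if "e \<in> set ?ds" for e
        proof (cases "e \<in> set (h d # cs)")
          case True
          then have "e \<in> A" using csA by blast
          then have "x < snd e" "snd e < z" by (auto simp: A_eq)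
          then show ?thesis using a_mid[OF True] abE(2) \<open>b = z\<close> by simp
        next
          case False
          then have "e \<in> set es" using that app by auto
          then show ?thesis by (rule cross)
        qed
        then show ?thesis using abE(1) by blast
      qed
    qed
    ultimately have "crossed_rainbow K E"
      by (metis crossed_rainbowI)
    then show False using no_crossing by simp
  qed
qed

text \<open>
  Edges of equal height are not nested. In such a family an edge is determined by its lower end if it
  has the smallest upper end for this lower end, and by its upper end otherwise.
\<close>

lemma card_A_le_projections: "card A \<le> card ((\<lambda>e. (\<eta> (\<rho> e), snd e)) ` A) + card ((\<lambda>e. (fst e, \<xi> (\<rho> e))) ` A)"
proof -
  have finA: "finite A" using finE A_sub finite_subset by blast
  have eta_inj: "\<rho> e = \<rho> e'" if "\<eta> (\<rho> e) = \<eta> (\<rho> e')" for e e'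
    using that eta(1) unfolding monotone_on_def by (metis UNIV_I less_irrefl linorder_neqE_nat)
  have xi_inj: "\<rho> e = \<rho> e'" if "\<xi> (\<rho> e) = \<xi> (\<rho> e')" "e \<in> A" "e' \<in> A" for e e'
    using that xi(1) height_bound unfolding monotone_on_def
    by (metis (mono_tags) mem_Collect_eq less_irrefl linorder_neqE_nat)
  \<comment> \<open>\<open>B\<close> consists of the edges that have the smallest upper end for their lower end and height\<close>
  define B where "B = {e \<in> A. \<forall>c \<in> A. \<rho> c = \<rho> e \<and> fst c = fst e \<longrightarrow> snd e \<le> snd c}"
  have "inj_on (\<lambda>e. (fst e, \<xi> (\<rho> e))) B"
    by (rule inj_onI) (metis (mono_tags, lifting) B_def Pair_inject mem_Collect_eq order_antisym prod_eqI xi_inj)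
  then have "card B = card ((\<lambda>e. (fst e, \<xi> (\<rho> e))) ` B)" by (simp add: card_image)
  also have "\<dots> \<le> card ((\<lambda>e. (fst e, \<xi> (\<rho> e))) ` A)"
    using finA by (intro card_mono) (auto simp: B_def)
  finally have 1: "card B \<le> card ((\<lambda>e. (fst e, \<xi> (\<rho> e))) ` A)" .
  have fst_le: "fst e' \<le> fst e" if e: "e \<in> A" "e' \<in> A - B" "\<rho> e = \<rho> e'" "snd e = snd e'" for e e'
  proof (rule ccontr)
    assume "\<not> fst e' \<le> fst e"
    obtain c where c: "c \<in> A" "\<rho> c = \<rho> e'" "fst c = fst e'" "snd c < snd e'"
      using e(2) by (auto simp: B_def)
    then have "nested e c" using \<open>\<not> fst e' \<le> fst e\<close> e(4) by (simp add: nested_def)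
    then show False using height_mono[OF e(1) c(1)] c(2) e(3) by simp
  qed
  have "inj_on (\<lambda>e. (\<eta> (\<rho> e), snd e)) (A - B)"
    by (rule inj_onI) (metis DiffD1 Pair_inject fst_le eta_inj order_antisym prod_eqI)
  then have "card (A - B) = card ((\<lambda>e. (\<eta> (\<rho> e), snd e)) ` (A - B))" by (simp add: card_image)
  also have "\<dots> \<le> card ((\<lambda>e. (\<eta> (\<rho> e), snd e)) ` A)"
    using finA by (intro card_mono) auto
  finally have 2: "card (A - B) \<le> card ((\<lambda>e. (\<eta> (\<rho> e), snd e)) ` A)" .
  have "card A = card B + card (A - B)"
    using finA by (metis (no_types, lifting) B_def card_Diff_subset card_mono finite_subset
        le_add_diff_inverse mem_Collect_eq subsetI)
  then show ?thesis using 1 2 by simp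
qed

lemma card_edges_le: "card E \<le> card right_part + card left_part"
proof -
  let ?R = "{e \<in> E. x \<le> fst e}" and ?L = "{e \<in> E. fst e \<le> x \<and> (snd e \<le> x \<or> snd e = z)}"
  have finA: "finite A" using finE A_sub finite_subset by blast
  have "E \<subseteq> ?R \<union> ?L \<union> A" using above by (force simp: A_eq)
  then have "card E \<le> card (?R \<union> ?L \<union> A)" using finE finA by (intro card_mono) auto
  also have "\<dots> \<le> card ?R + card ?L + card A"
    using card_Un_le[of "?R \<union> ?L" A] card_Un_le[of ?R ?L] by linarith
  finally have "card E \<le> card ?R + card ?L + card A" .
  moreover have "card right_part = card ?R + card ((\<lambda>e. (\<eta> (\<rho> e), snd e)) ` A)"
    unfolding right_part_def using finE finA eta(2) by (intro card_Un_disjoint) (auto simp: not_le[symmetric])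
  moreover have "card left_part = card ?L + card ((\<lambda>e. (fst e, \<xi> (\<rho> e))) ` A)"
    unfolding left_part_def using finE finA xi(2) height_bound
    by (intro card_Un_disjoint) (auto, force+)
  ultimately show ?thesis using card_A_le_projections by linarith
qed

end

section \<open>The number of edges without a crossed rainbow\<close>

definition degree_at :: "('a \<times> 'a) set \<Rightarrow> 'a \<Rightarrow> nat" where
  "degree_at E w = card {e \<in> E. fst e = w \<or> snd e = w}"

lemma sum_degree_at:
  assumes "finite W" "E \<subseteq> W \<times> W" "\<And>e. e \<in> E \<Longrightarrow> fst e \<noteq> snd e"
  shows "(\<Sum>w \<in> W. degree_at E w) = 2 * card E"
proof -
  have finE: "finite E" using assms(1,2) finite_subset by blast
  have "degree_at E w = card {e \<in> E. fst e = w} + card {e \<in> E. snd e = w}" for w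
  proof -
    have eq: "{e \<in> E. fst e = w \<or> snd e = w} = {e \<in> E. fst e = w} \<union> {e \<in> E. snd e = w}" by auto
    show ?thesis unfolding degree_at_def eq
      by (rule card_Un_disjoint) (use finE assms(3) in fastforce)+
  qed
  moreover have "(\<Sum>w \<in> W. card {e \<in> E. fst e = w}) = card E"
    using sum.group[OF finE assms(1), of fst "\<lambda>_. 1 :: nat"] assms(2) by force
  moreover have "(\<Sum>w \<in> W. card {e \<in> E. snd e = w}) = card E"
    using sum.group[OF finE assms(1), of snd "\<lambda>_. 1 :: nat"] assms(2) by force
  ultimately show ?thesis by (simp add: sum.distrib)
qed

lemma ex_element_of_rank:
  fixes S :: "'a :: linorder set"
  assumes "finite S" "j < card S"
  shows "\<exists>x \<in> S. card {s \<in> S. s < x} = j"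
  using assms
proof (induct arbitrary: j rule: finite_linorder_max_induct)
  case empty
  then show ?case by simp
next
  case (insert b A)
  show ?case
  proof (cases "j < card A")
    case True
    then obtain x where x: "x \<in> A" "card {s \<in> A. s < x} = j" using insert by blast
    moreover have "{s \<in> insert b A. s < x} = {s \<in> A. s < x}" using insert(2) x by fastforce
    ultimately show ?thesis by (intro bexI[of _ x]) auto
  next
    case False
    then have "j = card A" using insert by (metis card_insert_disjoint less_Suc_eq less_irrefl)
    moreover have "{s \<in> insert b A. s < b} = A" using insert(2) by auto
    ultimately show ?thesis by auto
  qed
qed

lemma card_edges_le_pairs:
  fixes E :: "('a :: linorder \<times> 'a) set"
  assumes "finite W" "E \<subseteq> W \<times> W" "\<And>e. e \<in> E \<Longrightarrow> fst e < snd e"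
  shows "2 * card E + card W \<le> card W * card W"
proof -
  have finE: "finite E" using assms(1,2) finite_subset by blast
  let ?D = "(\<lambda>w. (w, w)) ` W"
  have "card (prod.swap ` E) = card E" "card ?D = card W"
    by (auto intro!: card_image inj_onI)
  moreover have "card (E \<union> prod.swap ` E \<union> ?D) = card (E \<union> prod.swap ` E) + card ?D"
    using finE assms by (intro card_Un_disjoint) (auto, force+)
  moreover have "card (E \<union> prod.swap ` E) = card E + card (prod.swap ` E)"
  proof (rule card_Un_disjoint)
    have "prod.swap e \<notin> E" if "e \<in> E" for e
      using assms(3)[OF that] assms(3)[of "prod.swap e"] by auto
    then show "E \<inter> prod.swap ` E = {}" by blast
  qed (use finE in auto)
  moreover have "card (E \<union> prod.swap ` E \<union> ?D) \<le> card (W \<times> W)"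
    using assms by (intro card_mono) auto
  ultimately show ?thesis by (simp add: card_cartesian_product)
qed

text \<open>
  Induction on the number of vertices. With exactly \<open>3 * K\<close> vertices the bound is the number of
  all pairs. A vertex of degree at most \<open>(9 * K - 3) / 2\<close> can be deleted. Otherwise the last vertex
  has at least \<open>4 * K - 1\<close> neighbours, and the graph is split at an edge to one in the middle of
  them, so that both parts keep at least \<open>3 * K\<close> vertices. The \<open>K - 1\<close> new vertices on each side
  and the two vertices in both parts add up to \<open>2 * K\<close> more vertices in total, and this loss is
  what the term \<open>2 * K\<close> in the bound pays for.
\<close>

theorem card_edges_of_uncrossed:
  assumes "finite W" "E \<subseteq> W \<times> W" "\<And>e. e \<in> E \<Longrightarrow> fst e < snd e"
    and "\<not> crossed_rainbow K E" "0 < K" "3 * K \<le> card W"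
  shows "2 * int (card E) \<le> (9 * int K - 3) * (int (card W) - 2 * int K)"
  using assms(1-4,6)
proof (induct "card W" arbitrary: W E rule: less_induct)
  case less
  note W = less.prems(1) and EW = less.prems(2) and up = less.prems(3)
    and uncrossed = less.prems(4) and size = less.prems(5)
  have finE: "finite E" using W EW finite_subset by blast
  consider "card W = 3 * K"
    | (low) w where "w \<in> W" "2 * degree_at E w \<le> 9 * K - 3" "3 * K < card W"
    | (split) "\<And>w. w \<in> W \<Longrightarrow> 9 * K - 3 < 2 * degree_at E w" "3 * K < card W"
    using size by (meson le_neq_implies_less linorder_not_less)
  then show ?case
  proof cases
    case 1
    have "2 * int (card E) + int (card W) \<le> int (card W) * int (card W)"
      using card_edges_le_pairs[OF W EW up] by (metis of_nat_add of_nat_le_iff of_nat_mult of_nat_numeral)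
    then show ?thesis by (simp add: 1 algebra_simps)
  next
    case low
    let ?E = "{e \<in> E. fst e \<noteq> w \<and> snd e \<noteq> w}" and ?W = "W - {w}"
    have c: "card ?W = card W - 1" using low W by simp
    have "2 * int (card ?E) \<le> (9 * int K - 3) * (int (card ?W) - 2 * int K)"
    proof (rule less.hyps)
      show "\<not> crossed_rainbow K ?E" using uncrossed crossed_rainbow_mono[of K ?E E] by auto
    qed (use low W EW up c in auto)
    moreover have "card E = card ?E + degree_at E w"
    proof -
      have "E = ?E \<union> {e \<in> E. fst e = w \<or> snd e = w}" by auto
      then show ?thesis unfolding degree_at_def using finE
        by (subst card_Un_disjoint[symmetric]) auto
    qed
    moreover have "int (card ?W) = int (card W) - 1" using c low by simp
    moreover have "2 * int (degree_at E w) \<le> 9 * int K - 3" using low(2) assms(5) by linarith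
    ultimately show ?thesis by (simp add: algebra_simps)
  next
    case split
    define z where "z = Max W"
    have "W \<noteq> {}" using split(2) by auto
    then have z: "z \<in> W" "\<And>w. w \<in> W \<Longrightarrow> w \<le> z" using W by (auto simp: z_def)
    define S where "S = {u. (u, z) \<in> E}"
    have finS: "finite S" unfolding S_def
      using finite_subset[OF _ W, of "{u. (u, z) \<in> E}"] EW by auto
    have "{e \<in> E. fst e = z \<or> snd e = z} = (\<lambda>u. (u, z)) ` S"
    proof -
      have "fst e \<noteq> z" if "e \<in> E" for e using up[OF that] z(2)[of "snd e"] EW that by auto
      then show ?thesis by (force simp: S_def)
    qed
    then have "degree_at E z = card S" unfolding degree_at_def by (simp add: card_image inj_on_def)
    then have cS: "4 * K - 1 \<le> card S" using split(1)[OF z(1)] assms(5) by linarith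
    then have "2 * K - 1 < card S" using assms(5) by linarith
    then obtain x where x: "x \<in> S" "card {s \<in> S. s < x} = 2 * K - 1"
      using ex_element_of_rank[OF finS, of "2 * K - 1"] by blast
    have SW: "S \<subseteq> W" using EW by (auto simp: S_def)
    have xz: "(x, z) \<in> E" "x < z" using x(1) up[of "(x, z)"] by (auto simp: S_def)
    let ?U = "{w \<in> W. x \<le> w}" and ?D = "{w \<in> W. w \<le> x}"
    have Ulow: "2 * K + 1 \<le> card ?U"
    proof -
      have "S = {s \<in> S. s < x} \<union> {s \<in> S. x \<le> s}" by auto
      then have "card S \<le> card {s \<in> S. s < x} + card {s \<in> S. x \<le> s}" by (metis card_Un_le)
      then have "2 * K \<le> card {s \<in> S. x \<le> s}" using cS x(2) assms(5) by linarith
      moreover have "z \<notin> S" using up[of "(z, z)"] by (auto simp: S_def)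
      ultimately have "2 * K + 1 \<le> card (insert z {s \<in> S. x \<le> s})" using finS by simp
      also have "\<dots> \<le> card ?U" using W SW z xz by (intro card_mono) auto
      finally show ?thesis .
    qed
    have Dlow: "2 * K \<le> card ?D"
    proof -
      have "2 * K = card (insert x {s \<in> S. s < x})" using finS x(2) assms(5) by simp
      also have "\<dots> \<le> card ?D" using W SW x(1) by (intro card_mono) auto
      finally show ?thesis .
    qed
    have UD: "card ?U + card ?D = card W + 1"
    proof -
      have "?U \<union> ?D = W" "?U \<inter> ?D = {x}" using x(1) SW by auto
      then show ?thesis using card_Un_Int[of ?U ?D] W by simp
    qed
    define A where "A = {e \<in> E. fst e < x \<and> x < snd e \<and> snd e < z}"
    have AE: "A \<subseteq> E" by (auto simp: A_def)
    have "transp nested" "irreflp nested" by (auto simp: nested_def intro!: transpI irreflpI)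
    then obtain \<rho> where \<rho>: "\<And>e c. e \<in> A \<Longrightarrow> c \<in> A \<Longrightarrow> nested e c \<Longrightarrow> \<rho> c < \<rho> e"
      "\<And>e m. e \<in> A \<Longrightarrow> \<rho> e = Suc m \<Longrightarrow> \<exists>c \<in> A. nested e c \<and> \<rho> c = m"
      "\<And>e. e \<in> A \<Longrightarrow> \<exists>es. length es = Suc (\<rho> e) \<and> set es \<subseteq> A \<and> sorted_wrt nested es"
      using ex_chain_height[of A nested] finite_subset[OF AE finE] by blast
    have bound: "Suc (\<rho> e) < K" if "e \<in> A" for e
    proof (rule ccontr)
      assume "\<not> Suc (\<rho> e) < K"
      moreover obtain es where es: "length es = Suc (\<rho> e)" "set es \<subseteq> A" "sorted_wrt nested es"
        using \<rho>(3) \<open>e \<in> A\<close> by blast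
      ultimately have "crossed_rainbow K E"
        using xz(1) AE set_take_subset[of K es]
        by (intro crossed_rainbowI[of "take K es" K E x z]) (auto simp: A_def sorted_wrt_take)
      then show False using uncrossed by simp
    qed
    \<comment> \<open>any positions below \<open>x\<close> and between \<open>x\<close> and \<open>z\<close> with the right monotonicity would do\<close>
    define \<eta> where "\<eta> r = x - 1 - real r" for r
    define \<xi> where "\<xi> r = x + (z - x) * (real r + 1) / real K" for r
    have xi_mono: "strict_mono_on UNIV \<xi>"
      using xz assms(5) by (auto simp: monotone_on_def \<xi>_def divide_strict_right_mono)
    have xi_mid: "x < \<xi> r \<and> \<xi> r < z" if "Suc r < K" for r
    proof -
      have "(z - x) * (real r + 1) < (z - x) * real K" using that xz by (intro mult_strict_left_mono) auto
      then have "(z - x) * (real r + 1) / real K < z - x" using assms(5) by (simp add: pos_divide_less_eq)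
      moreover have "0 < (z - x) * (real r + 1) / real K" using xz assms(5) by simp
      ultimately show ?thesis unfolding \<xi>_def by linarith
    qed
    interpret split_at_edge K E x z A \<rho> \<eta> \<xi>
    proof
      show "strict_antimono_on UNIV \<eta>" by (auto simp: monotone_on_def \<eta>_def)
      show "strict_mono_on {r. Suc r < K} \<xi>" using xi_mono monotone_on_subset by blast
      show "snd e \<le> z" if "e \<in> E" for e using that EW z by auto
      show "\<eta> r < x" for r by (simp add: \<eta>_def)
    qed (use finE assms(5) uncrossed xz(1) up \<rho> bound xi_mid A_def in auto)
    let ?I = "{r. Suc r < K}"
    have I: "card ?I = K - 1" "finite ?I"
    proof -
      have "?I = {..<K - 1}" by auto
      then show "card ?I = K - 1" "finite ?I" by simp_all
    qed
    let ?WR = "?U \<union> \<eta> ` ?I" and ?WL = "insert z ?D \<union> \<xi> ` ?I"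
    have cR: "card ?WR = card ?U + (K - 1)"
    proof -
      have "card ?WR = card ?U + card (\<eta> ` ?I)"
        using W I by (intro card_Un_disjoint) (auto simp: \<eta>_def)
      moreover have "inj_on \<eta> ?I" by (auto simp: inj_on_def \<eta>_def)
      ultimately show ?thesis using I by (simp add: card_image)
    qed
    have cL: "card ?WL = card ?D + K"
    proof -
      have "card ?WL = card (insert z ?D) + card (\<xi> ` ?I)"
        using W I xi_mid xz by (intro card_Un_disjoint) (auto, force+)
      moreover have "inj_on \<xi> ?I"
        using xi_mono by (meson inj_on_subset strict_mono_on_imp_inj_on subset_UNIV)
      moreover have "z \<notin> ?D" using xz by auto
      ultimately show ?thesis using I W assms(5) by (simp add: card_image)
    qed
    have AW: "fst e \<in> W" "snd e \<in> W" if "e \<in> E" for e using that EW by auto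
    have "2 * int (card right_part) \<le> (9 * int K - 3) * (int (card ?WR) - 2 * int K)"
    proof (rule less.hyps)
      show "card ?WR < card W" "3 * K \<le> card ?WR" using cR UD Ulow Dlow assms(5) by linarith+
      show "right_part \<subseteq> ?WR \<times> ?WR"
      proof
        fix e assume "e \<in> right_part"
        then consider "e \<in> E" "x \<le> fst e" | c where "c \<in> A" "e = (\<eta> (\<rho> c), snd c)"
          by (auto simp: right_part_def)
        then show "e \<in> ?WR \<times> ?WR"
        proof cases
          case 1
          then show ?thesis using AW[of e] up[of e] by (cases e) auto
        next
          case 2
          then have "snd c \<in> ?U" "\<rho> c \<in> ?I" using AW(2)[of c] bound by (auto simp: A_def)
          then show ?thesis using 2(2) by blast
        qed
      qed
      show "fst e < snd e" if e: "e \<in> right_part" for e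
      proof -
        consider "e \<in> E" | c where "c \<in> A" "e = (\<eta> (\<rho> c), snd c)"
          using e by (auto simp: right_part_def)
        then show ?thesis
        proof cases
          case 2
          then show ?thesis using eta(2)[of "\<rho> c"] by (auto simp: A_def)
        qed (rule up)
      qed
    qed (use W I right_part_not_crossed in auto)
    moreover have "2 * int (card left_part) \<le> (9 * int K - 3) * (int (card ?WL) - 2 * int K)"
    proof (rule less.hyps)
      show "card ?WL < card W" "3 * K \<le> card ?WL" using cL UD Ulow Dlow assms(5) by linarith+
      show "left_part \<subseteq> ?WL \<times> ?WL"
      proof
        fix e assume "e \<in> left_part"
        then consider "e \<in> E" "fst e \<le> x" "snd e \<le> x \<or> snd e = z"
          | c where "c \<in> A" "e = (fst c, \<xi> (\<rho> c))"
          by (auto simp: left_part_def)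
        then show "e \<in> ?WL \<times> ?WL"
        proof cases
          case 1
          then show ?thesis using AW[of e] by (cases e) auto
        next
          case 2
          then have "fst c \<in> ?D" "\<rho> c \<in> ?I" using AW(1)[of c] bound by (auto simp: A_def)
          then show ?thesis using 2(2) by blast
        qed
      qed
      show "fst e < snd e" if e: "e \<in> left_part" for e
      proof -
        consider "e \<in> E" | c where "c \<in> A" "e = (fst c, \<xi> (\<rho> c))"
          using e by (auto simp: left_part_def)
        then show ?thesis
        proof cases
          case 2
          then show ?thesis using xi_mid[OF bound[OF 2(1)]] by (auto simp: A_def)
        qed (rule up)
      qed
    qed (use W I left_part_not_crossed in auto)
    ultimately have "2 * int (card right_part) + 2 * int (card left_part)
        \<le> (9 * int K - 3) * (int (card ?WR) + int (card ?WL) - 4 * int K)"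
      by (simp add: algebra_simps)
    also have "int (card ?WR) + int (card ?WL) - 4 * int K = int (card W) - 2 * int K"
      using cR cL UD assms(5) by linarith
    finally show ?thesis using card_edges_le by linarith
  qed
qed

corollary ex_low_degree_of_uncrossed:
  assumes "finite W" "W \<noteq> {}" "E \<subseteq> W \<times> W" "\<And>e. e \<in> E \<Longrightarrow> fst e < snd e"
    and "\<not> crossed_rainbow K E" "0 < K"
  shows "\<exists>w \<in> W. degree_at E w < 9 * K - 3"
proof (rule ccontr)
  assume "\<not> ?thesis"
  then have deg: "9 * K - 3 \<le> degree_at E w" if "w \<in> W" for w using that by auto
  have finE: "finite E" using assms(1,3) finite_subset by blast
  have "(\<Sum>w \<in> W. 9 * K - 3) \<le> (\<Sum>w \<in> W. degree_at E w)" using deg by (rule sum_mono)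
  also have "\<dots> = 2 * card E" using assms by (intro sum_degree_at) force+
  finally have le: "card W * (9 * K - 3) \<le> 2 * card E" by simp
  have pairs: "2 * card E + card W \<le> card W * card W" using card_edges_le_pairs assms by blast
  have "0 < card W" using assms by auto
  moreover have "card W * (9 * K - 3 + 1) \<le> card W * card W" using le pairs by (simp add: algebra_simps)
  ultimately have big: "9 * K - 3 + 1 \<le> card W" using nat_mult_le_cancel1 by blast
  then have "2 * int (card E) \<le> (9 * int K - 3) * (int (card W) - 2 * int K)"
    using assms by (intro card_edges_of_uncrossed) auto
  also have "\<dots> < (9 * int K - 3) * int (card W)"
    using assms(6) by (intro mult_strict_left_mono) auto
  also have "\<dots> = int (card W * (9 * K - 3))" using assms(6) by (simp add: of_nat_diff)
  also have "\<dots> \<le> int (2 * card E)" using le by (simp only: of_nat_le_iff)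
  finally show False by simp
qed

section \<open>Subgraphs of large minimum degree\<close>

text \<open>
  Greedy colouring: remove a vertex with fewer than \<open>d\<close> neighbours, colour the rest, and give the
  vertex a colour that its neighbours do not use.
\<close>

lemma coloring_of_degenerate:
  assumes "finite V" "\<And>u v. adj u v \<Longrightarrow> adj v u" "\<And>v. \<not> adj v v"
    and "\<And>X. X \<subseteq> V \<Longrightarrow> X \<noteq> {} \<Longrightarrow> \<exists>x \<in> X. card {y \<in> X. adj x y} < d"
  shows "\<exists>c. (\<forall>v \<in> V. c v < d) \<and> (\<forall>u \<in> V. \<forall>v \<in> V. adj u v \<longrightarrow> c u \<noteq> (c v :: nat))"
  using assms(1,4)
proof (induct "card V" arbitrary: V)
  case 0
  then show ?case by simp
next
  case (Suc k)
  have "V \<noteq> {}" using Suc.hyps(2) by auto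
  then obtain x where x: "x \<in> V" "card {y \<in> V. adj x y} < d" using Suc.prems(2)[of V] by auto
  have "\<exists>c. (\<forall>v \<in> V - {x}. c v < d) \<and> (\<forall>u \<in> V - {x}. \<forall>v \<in> V - {x}. adj u v \<longrightarrow> c u \<noteq> c v)"
  proof (rule Suc.hyps(1))
    show "k = card (V - {x})" using Suc.hyps(2) x(1) Suc.prems(1) by simp
    show "\<exists>y \<in> X. card {z \<in> X. adj y z} < d" if "X \<subseteq> V - {x}" "X \<noteq> {}" for X
      using that Suc.prems(2)[of X] by auto
  qed (use Suc.prems(1) in simp)
  then obtain c where c: "\<And>v. v \<in> V - {x} \<Longrightarrow> c v < d"
    "\<And>u v. u \<in> V - {x} \<Longrightarrow> v \<in> V - {x} \<Longrightarrow> adj u v \<Longrightarrow> c u \<noteq> c v" by auto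
  have "card (c ` {y \<in> V. adj x y}) < card {..<d}"
    using card_image_le[of "{y \<in> V. adj x y}" c] Suc.prems(1) x(2) by simp
  then have "\<not> {..<d} \<subseteq> c ` {y \<in> V. adj x y}"
    using Suc.prems(1) card_mono[of "c ` {y \<in> V. adj x y}" "{..<d}"] by auto
  then obtain a where a: "a < d" "a \<notin> c ` {y \<in> V. adj x y}" by auto
  have "(\<forall>v \<in> V. (c(x := a)) v < d) \<and> (\<forall>u \<in> V. \<forall>v \<in> V. adj u v \<longrightarrow> (c(x := a)) u \<noteq> (c(x := a)) v)"
  proof (intro conjI ballI impI)
    fix v assume "v \<in> V"
    then show "(c(x := a)) v < d" using c(1)[of v] a(1) by auto
  next
    fix u v assume uv: "u \<in> V" "v \<in> V" "adj u v"
    consider "u = x" "v \<noteq> x" | "u \<noteq> x" "v = x" | "u \<noteq> x" "v \<noteq> x" using uv(3) assms(3) by auto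
    then show "(c(x := a)) u \<noteq> (c(x := a)) v"
    proof cases
      case 1
      then show ?thesis using uv a(2) by auto
    next
      case 2
      then show ?thesis using uv a(2) assms(2)[of u v] by auto
    next
      case 3
      then show ?thesis using uv c(2)[of u v] by auto
    qed
  qed
  then show ?case by blast
qed

lemma ex_subset_of_large_degree:
  assumes "oriented_graph H" "d < chromatic_number H"
  shows "\<exists>X. X \<subseteq> pverts H \<and> X \<noteq> {} \<and>
           (\<forall>x \<in> X. d \<le> card {y \<in> X. (x, y) \<in> parcs H \<or> (y, x) \<in> parcs H})"
proof (rule ccontr)
  assume neg: "\<not> ?thesis"
  interpret oriented_graph H by fact
  let ?adj = "\<lambda>u v. (u, v) \<in> parcs H \<or> (v, u) \<in> parcs H"
  have "\<exists>c. (\<forall>v \<in> pverts H. c v < d) \<and>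
      (\<forall>u \<in> pverts H. \<forall>v \<in> pverts H. ?adj u v \<longrightarrow> c u \<noteq> (c v :: nat))"
    using neg by (intro coloring_of_degenerate) (auto simp: not_le[symmetric] dest: no_loops')
  then obtain c where c: "\<And>v. v \<in> pverts H \<Longrightarrow> c v < d"
    "\<And>u v. (u, v) \<in> parcs H \<Longrightarrow> c u \<noteq> c v"
    by (metis in_arcsD1 in_arcsD2)
  then have "proper_coloring (with_proj (mk_symmetric (with_proj H))) d c"
    unfolding proper_coloring_def by (fastforce simp: parcs_mk_symmetric)
  then have "chromatic_number H \<le> d"
    unfolding chromatic_number_def graph_chromatic_number_def by (intro Least_le) blast
  then show False using assms(2) by simp
qed

section \<open>Walks that spell a word of directions\<close>

definition signed_arc :: "('a \<times> 'a) set \<Rightarrow> bool \<Rightarrow> 'a \<Rightarrow> 'a \<Rightarrow> bool" where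
  "signed_arc R s u v \<longleftrightarrow> (if s then (u, v) \<in> R else (v, u) \<in> R)"

text \<open>
  A walk is a list of vertices in which each arc may be traversed in either direction. The walk spells a
  word if it is obtained from it by stretching each letter to a nonempty run of steps in the
  direction of this letter; \<open>h i\<close> is the position at which the \<open>i\<close>-th run starts.
\<close>

definition spells :: "('a \<times> 'a) set \<Rightarrow> 'a list \<Rightarrow> bool list \<Rightarrow> bool" where
  "spells R ws ss \<longleftrightarrow>
     (\<exists>h. h 0 = 0 \<and> length ws = Suc (h (length ss)) \<and> (\<forall>i < length ss. h i < h (Suc i)) \<and>
        (\<forall>i < length ss. \<forall>j. h i \<le> j \<and> j < h (Suc i) \<longrightarrow> signed_arc R (ss ! i) (ws ! j) (ws ! Suc j)))"

lemma spells_Nil: "spells R [w] []"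
  unfolding spells_def by (intro exI[of _ "\<lambda>_. 0"]) auto

lemma mono_of_steps:
  fixes h :: "nat \<Rightarrow> nat"
  assumes "\<And>i. i < n \<Longrightarrow> h i < h (Suc i)" "i \<le> j" "j \<le> n"
  shows "h i \<le> h j"
  using assms(2,3)
proof (induct j rule: dec_induct)
  case (step j)
  then show ?case using assms(1)[of j] by simp
qed simp

lemma strict_mono_of_steps:
  fixes h :: "nat \<Rightarrow> nat"
  assumes "\<And>i. i < n \<Longrightarrow> h i < h (Suc i)" "i < j" "j \<le> n"
  shows "h i < h j"
  using mono_of_steps[of n h "Suc i" j] assms(1)[of i] assms(2,3) assms(1) by fastforce

lemma spells_new_letter:
  assumes "spells R ws ss" "signed_arc R s (last ws) w"
  shows "spells R (ws @ [w]) (ss @ [s])"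
proof -
  obtain h where h: "h 0 = 0" "length ws = Suc (h (length ss))" "\<And>i. i < length ss \<Longrightarrow> h i < h (Suc i)"
    "\<And>i j. i < length ss \<Longrightarrow> h i \<le> j \<Longrightarrow> j < h (Suc i) \<Longrightarrow> signed_arc R (ss ! i) (ws ! j) (ws ! Suc j)"
    using assms(1) unfolding spells_def by blast
  have le: "h (Suc i) \<le> h (length ss)" if "i < length ss" for i
    using mono_of_steps[of "length ss" h "Suc i" "length ss"] h(3) that by auto
  define g where "g = h(Suc (length ss) := Suc (h (length ss)))"
  have g: "g i = h i" if "i \<le> length ss" for i using that by (simp add: g_def)
  have "signed_arc R ((ss @ [s]) ! i) ((ws @ [w]) ! j) ((ws @ [w]) ! Suc j)"
    if "i < length (ss @ [s])" "g i \<le> j" "j < g (Suc i)" for i j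
  proof (cases "i < length ss")
    case True
    then have "h i \<le> j" "j < h (Suc i)" using that g[of i] g[of "Suc i"] by auto
    then show ?thesis using h(4)[OF True] h(2) le[OF True] True by (simp add: nth_append)
  next
    case False
    then have "i = length ss" using that by simp
    moreover from this have "j = h (length ss)" using that by (simp add: g_def)
    moreover have "ws \<noteq> []" using h(2) by auto
    ultimately show ?thesis using assms(2) h(2) by (simp add: nth_append last_conv_nth)
  qed
  then show ?thesis unfolding spells_def using h
    by (intro exI[of _ g]) (auto simp: g_def less_Suc_eq)
qed

lemma spells_extend_last:
  assumes "spells R ws ss" "ss \<noteq> []" "signed_arc R (last ss) (last ws) w"
  shows "spells R (ws @ [w]) ss"
proof -
  obtain h where h: "h 0 = 0" "length ws = Suc (h (length ss))" "\<And>i. i < length ss \<Longrightarrow> h i < h (Suc i)"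
    "\<And>i j. i < length ss \<Longrightarrow> h i \<le> j \<Longrightarrow> j < h (Suc i) \<Longrightarrow> signed_arc R (ss ! i) (ws ! j) (ws ! Suc j)"
    using assms(1) unfolding spells_def by blast
  have le: "h (Suc i) \<le> h (length ss)" if "i < length ss" for i
    using mono_of_steps[of "length ss" h "Suc i" "length ss"] h(3) that by auto
  define g where "g = h(length ss := Suc (h (length ss)))"
  have g: "g i = h i" if "i < length ss" for i using that by (simp add: g_def)
  have "signed_arc R (ss ! i) ((ws @ [w]) ! j) ((ws @ [w]) ! Suc j)"
    if "i < length ss" "g i \<le> j" "j < g (Suc i)" for i j
  proof (cases "j < h (Suc i)")
    case True
    then show ?thesis using h(4)[OF that(1) _ True] h(2) le[OF that(1)] that g[of i] by (simp add: nth_append)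
  next
    case False
    then have "Suc i = length ss" using that g[of "Suc i"] by (metis Suc_lessI)
    moreover from this have "j = h (length ss)" using that False by (simp add: g_def)
    moreover have "ws \<noteq> []" "i = length ss - 1" using h(2) \<open>Suc i = length ss\<close> by auto
    ultimately show ?thesis using assms(2,3) h(2) by (simp add: nth_append last_conv_nth)
  qed
  moreover have "g i < g (Suc i)" if "i < length ss" for i
    using that h(3)[OF that] by (auto simp: g_def)
  ultimately show ?thesis unfolding spells_def using h assms(2)
    by (intro exI[of _ g]) (auto simp: g_def)
qed

lemma spells_extend_first:
  assumes "spells R ws (s # ss)" "signed_arc R s w (hd ws)"
  shows "spells R (w # ws) (s # ss)"
proof -
  obtain h where h: "h 0 = 0" "length ws = Suc (h (length (s # ss)))"
    "\<And>i. i < length (s # ss) \<Longrightarrow> h i < h (Suc i)"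
    "\<And>i j. i < length (s # ss) \<Longrightarrow> h i \<le> j \<Longrightarrow> j < h (Suc i) \<Longrightarrow>
       signed_arc R ((s # ss) ! i) (ws ! j) (ws ! Suc j)"
    using assms(1) unfolding spells_def by blast
  define g where "g i = (if i = 0 then 0 else Suc (h i))" for i
  have "signed_arc R ((s # ss) ! i) ((w # ws) ! j) ((w # ws) ! Suc j)"
    if "i < length (s # ss)" "g i \<le> j" "j < g (Suc i)" for i j
  proof (cases j)
    case 0
    then have "i = 0" using that by (auto simp: g_def split: if_splits)
    moreover have "ws \<noteq> []" using h(2) by auto
    ultimately show ?thesis using 0 assms(2) by (simp add: hd_conv_nth)
  next
    case (Suc k)
    then have "h i \<le> k" "k < h (Suc i)" using that h(1) by (auto simp: g_def split: if_splits)
    then show ?thesis using h(4)[OF that(1)] Suc by simp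
  qed
  moreover have "g i < g (Suc i)" if "i < length (s # ss)" for i
    using that h(3)[OF that] by (auto simp: g_def)
  ultimately show ?thesis unfolding spells_def using h(2)
    by (intro exI[of _ g]) (auto simp: g_def)
qed

lemma spells_map:
  assumes "spells R ws ss" "\<And>u v. (u, v) \<in> R \<Longrightarrow> (f u, f v) \<in> R'"
  shows "spells R' (map f ws) ss"
proof -
  obtain h where h: "h 0 = 0" "length ws = Suc (h (length ss))" "\<And>i. i < length ss \<Longrightarrow> h i < h (Suc i)"
    "\<And>i j. i < length ss \<Longrightarrow> h i \<le> j \<Longrightarrow> j < h (Suc i) \<Longrightarrow> signed_arc R (ss ! i) (ws ! j) (ws ! Suc j)"
    using assms(1) unfolding spells_def by blast
  have le: "h (Suc i) \<le> h (length ss)" if "i < length ss" for i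
    using mono_of_steps[of "length ss" h "Suc i" "length ss"] h(3) that by auto
  have "signed_arc R' (ss ! i) (map f ws ! j) (map f ws ! Suc j)"
    if "i < length ss" "h i \<le> j" "j < h (Suc i)" for i j
    using h(4)[OF that] that(3) le[OF that(1)] h(2) assms(2) by (auto simp: signed_arc_def split: if_splits)
  then show ?thesis unfolding spells_def using h by (intro exI[of _ h]) auto
qed

lemma spells_extend_up:
  assumes "\<And>i. Suc i < N \<Longrightarrow> (i, Suc i) \<in> R" "b < N"
    and "spells R ws ss" "ss \<noteq> []" "last ss" "last ws \<le> b"
  shows "spells R (ws @ [Suc (last ws)..<Suc b]) ss"
  using assms(6,2)
proof (induct b rule: dec_induct)
  case base
  then show ?case using assms(3) by simp
next
  case (step b)
  have "ws \<noteq> []" using assms(3) unfolding spells_def by auto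
  then have "last (ws @ [Suc (last ws)..<Suc b]) = b"
    using step.hyps(1) by (auto simp: last_append le_less)
  then have "spells R ((ws @ [Suc (last ws)..<Suc b]) @ [Suc b]) ss"
    using step assms(1,4,5) by (intro spells_extend_last) (auto simp: signed_arc_def)
  then show ?case using step.hyps(1) by simp
qed

lemma spells_extend_down:
  assumes "\<And>i. Suc i < N \<Longrightarrow> (i, Suc i) \<in> R" "last ws < N"
    and "spells R ws ss" "ss \<noteq> []" "\<not> last ss" "b \<le> last ws"
  shows "spells R (ws @ rev [b..<last ws]) ss"
  using assms(6)
proof (induct b rule: inc_induct)
  case base
  then show ?case using assms(3) by simp
next
  case (step b)
  have "ws \<noteq> []" using assms(3) unfolding spells_def by auto
  then have "last (ws @ rev [Suc b..<last ws]) = Suc b"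
    using step.hyps(2) by (auto simp: last_append last_rev)
  then have "spells R ((ws @ rev [Suc b..<last ws]) @ [b]) ss"
    using step assms(1,2,4,5) by (intro spells_extend_last) (auto simp: signed_arc_def)
  then show ?case using step.hyps(2) by (simp add: upt_conv_Cons)
qed

lemma spells_new_up:
  assumes "\<And>i. Suc i < N \<Longrightarrow> (i, Suc i) \<in> R" "b < N" "spells R ws ss" "last ws < b"
  shows "spells R (ws @ [Suc (last ws)..<Suc b]) (ss @ [True])"
proof -
  have "spells R (ws @ [Suc (last ws)]) (ss @ [True])"
    using assms by (intro spells_new_letter) (auto simp: signed_arc_def)
  then have "spells R ((ws @ [Suc (last ws)]) @ [Suc (last (ws @ [Suc (last ws)]))..<Suc b]) (ss @ [True])"
    using assms by (intro spells_extend_up[of N]) auto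
  moreover have "[Suc (last ws)..<Suc b] = Suc (last ws) # [Suc (Suc (last ws))..<Suc b]"
    using assms(4) by (intro upt_conv_Cons) simp
  ultimately show ?thesis by (simp del: upt_Suc)
qed

lemma spells_new_down:
  assumes "\<And>i. Suc i < N \<Longrightarrow> (i, Suc i) \<in> R" "last ws < N" "spells R ws ss" "b < last ws"
  shows "spells R (ws @ rev [b..<last ws]) (ss @ [False])"
proof -
  obtain a where a: "last ws = Suc a" using assms(4) by (cases "last ws") auto
  have "spells R (ws @ [a]) (ss @ [False])"
    using assms a by (intro spells_new_letter) (auto simp: signed_arc_def)
  then have "spells R ((ws @ [a]) @ rev [b..<last (ws @ [a])]) (ss @ [False])"
    using assms a by (intro spells_extend_down[of N]) auto
  then show ?thesis using assms(4) a by simp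
qed

text \<open>
  A single edge in an unknown direction can be absorbed when a walk is about to turn: it either
  prolongs the last letter or starts the opposite one.
\<close>

lemma spells_turn:
  assumes "spells R ws ss" "ss \<noteq> []" "(last ws, c) \<in> R \<or> (c, last ws) \<in> R"
  shows "spells R (ws @ [c]) ss \<or> spells R (ws @ [c]) (ss @ [\<not> last ss])"
  using assms spells_extend_last[OF assms(1,2)] spells_new_letter[OF assms(1), of _ c]
  unfolding signed_arc_def by metis

section \<open>Reading a cycle in a crossed rainbow\<close>

text \<open>
  The rainbow in the positions on the Hamiltonian path: rungs \<open>u i\<close>, \<open>v i\<close>, numbered from the
  outside, and two rails, which are segments of the path. Moving inwards follows the path along the
  \<open>u i\<close> and goes against it along the \<open>v i\<close>.
\<close>

locale crossed_ladder =
  fixes N K :: nat and R :: "(nat \<times> nat) set" and u v :: "nat \<Rightarrow> nat" and x y :: nat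
  assumes rail: "\<And>i. Suc i < N \<Longrightarrow> (i, Suc i) \<in> R"
    and u_mono: "\<And>i j. i < j \<Longrightarrow> j < K \<Longrightarrow> u i < u j"
    and v_anti: "\<And>i j. i < j \<Longrightarrow> j < K \<Longrightarrow> v j < v i"
    and rung: "\<And>i. i < K \<Longrightarrow> (u i, v i) \<in> R \<or> (v i, u i) \<in> R"
    and crossing: "(x, y) \<in> R \<or> (y, x) \<in> R"
    and between: "\<And>i. i < K \<Longrightarrow> u i < x \<and> x < v i \<and> v i \<le> y" and y_less: "y < N"
    and K: "2 \<le> K"
begin

text \<open>
  The walk starts at \<open>y\<close> and has come to rung \<open>i\<close> on the rail that corresponds to its last letter. All
  positions between \<open>u i\<close> and \<open>v i\<close> are still unused, and so is the other end of rung \<open>i\<close>; this is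
  what allows the walk to cross the rung next.
\<close>

definition reaches_rung :: "nat \<Rightarrow> bool list \<Rightarrow> nat list \<Rightarrow> bool" where
  "reaches_rung i ss ws \<longleftrightarrow> ss \<noteq> [] \<and> spells R ws ss \<and> distinct ws \<and> hd ws = y \<and>
     (if last ss then last ws = u i \<and> (\<forall>w \<in> set ws. w \<le> u i \<or> v i < w)
      else last ws = v i \<and> (\<forall>w \<in> set ws. w < u i \<or> v i \<le> w))"

lemma v_less: "i < K \<Longrightarrow> v i < N"
  using between y_less by (meson le_less_trans)

text \<open>
  A forward letter is read on the \<open>u\<close>-rail. If the walk is on the other rail, it first crosses the
  rung, whose direction does not matter by \<open>spells_turn\<close>. The target \<open>b\<close> is the next rung or, for the
  last letter, the vertex \<open>x\<close>.
\<close>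

lemma forward_letter_step:
  assumes "reaches_rung i ss ws" "i < K" "u i < b" "b < v i"
  shows "\<exists>ws'. spells R ws' (ss @ [True]) \<and> distinct ws' \<and> hd ws' = y \<and> last ws' = b \<and>
           (\<forall>w \<in> set ws'. w \<le> b \<or> v i \<le> w)"
proof -
  have bN: "b < N" using assms(4) v_less[OF assms(2)] by simp
  have ne: "ws \<noteq> []" using assms(1) unfolding reaches_rung_def spells_def by auto
  show ?thesis
  proof (cases "last ss")
    case True
    then have ws: "last ws = u i" "\<And>w. w \<in> set ws \<Longrightarrow> w \<le> u i \<or> v i < w"
      using assms(1) by (auto simp: reaches_rung_def)
    then have "spells R (ws @ [Suc (u i)..<Suc b]) (ss @ [True])"
      using spells_new_up[OF rail bN, of ws ss] assms by (auto simp: reaches_rung_def)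
    moreover have "distinct (ws @ [Suc (u i)..<Suc b])"
      using assms(1,4) ws(2) by (fastforce simp: reaches_rung_def)
    moreover have "\<forall>w \<in> set (ws @ [Suc (u i)..<Suc b]). w \<le> b \<or> v i \<le> w"
      using ws(2) assms(3) by fastforce
    ultimately show ?thesis using assms ne
      by (intro exI[of _ "ws @ [Suc (u i)..<Suc b]"]) (auto simp: reaches_rung_def)
  next
    case False
    then have ws: "last ws = v i" "\<And>w. w \<in> set ws \<Longrightarrow> w < u i \<or> v i \<le> w"
      using assms(1) by (auto simp: reaches_rung_def)
    have "spells R (ws @ [u i]) ss \<or> spells R (ws @ [u i]) (ss @ [True])"
      using spells_turn[of R ws ss "u i"] assms(1) rung[OF assms(2)] ws(1) False
      by (auto simp: reaches_rung_def)
    then have "spells R ((ws @ [u i]) @ [Suc (u i)..<Suc b]) (ss @ [True])"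
    proof
      assume "spells R (ws @ [u i]) ss"
      then show ?thesis using spells_new_up[OF rail bN, of "ws @ [u i]" ss] assms(3) by simp
    next
      assume "spells R (ws @ [u i]) (ss @ [True])"
      then show ?thesis
        using spells_extend_up[OF rail bN, of "ws @ [u i]" "ss @ [True]"] assms(3) by simp
    qed
    moreover have "distinct ((ws @ [u i]) @ [Suc (u i)..<Suc b])"
      using assms(1,3,4) ws(2) by (fastforce simp: reaches_rung_def)
    moreover have "\<forall>w \<in> set ((ws @ [u i]) @ [Suc (u i)..<Suc b]). w \<le> b \<or> v i \<le> w"
      using ws(2) assms(3) by fastforce
    ultimately show ?thesis using assms ne
      by (intro exI[of _ "(ws @ [u i]) @ [Suc (u i)..<Suc b]"]) (auto simp: reaches_rung_def)
  qed
qed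

lemma backward_letter_step:
  assumes "reaches_rung i ss ws" "i < K" "b < v i" "u i < b"
  shows "\<exists>ws'. spells R ws' (ss @ [False]) \<and> distinct ws' \<and> hd ws' = y \<and> last ws' = b \<and>
           (\<forall>w \<in> set ws'. w \<le> u i \<or> b \<le> w)"
proof -
  have vN: "v i < N" using v_less[OF assms(2)] .
  have ne: "ws \<noteq> []" using assms(1) unfolding reaches_rung_def spells_def by auto
  show ?thesis
  proof (cases "last ss")
    case False
    then have ws: "last ws = v i" "\<And>w. w \<in> set ws \<Longrightarrow> w < u i \<or> v i \<le> w"
      using assms(1) by (auto simp: reaches_rung_def)
    then have "spells R (ws @ rev [b..<v i]) (ss @ [False])"
      using spells_new_down[OF rail, of N ws ss b] assms vN by (auto simp: reaches_rung_def)
    moreover have "distinct (ws @ rev [b..<v i])"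
      using assms(1,4) ws(2) by (fastforce simp: reaches_rung_def)
    moreover have "\<forall>w \<in> set (ws @ rev [b..<v i]). w \<le> u i \<or> b \<le> w"
      using ws(2) assms(3) by fastforce
    ultimately show ?thesis using assms ne
      by (intro exI[of _ "ws @ rev [b..<v i]"]) (auto simp: reaches_rung_def last_append last_rev)
  next
    case True
    then have ws: "last ws = u i" "\<And>w. w \<in> set ws \<Longrightarrow> w \<le> u i \<or> v i < w"
      using assms(1) by (auto simp: reaches_rung_def)
    have "spells R (ws @ [v i]) ss \<or> spells R (ws @ [v i]) (ss @ [False])"
      using spells_turn[of R ws ss "v i"] assms(1) rung[OF assms(2)] ws(1) True
      by (auto simp: reaches_rung_def)
    then have "spells R ((ws @ [v i]) @ rev [b..<v i]) (ss @ [False])"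
    proof
      assume "spells R (ws @ [v i]) ss"
      then show ?thesis using spells_new_down[OF rail, of N "ws @ [v i]" ss b] assms(3) vN by simp
    next
      assume "spells R (ws @ [v i]) (ss @ [False])"
      then show ?thesis
        using spells_extend_down[OF rail, of N "ws @ [v i]" "ss @ [False]" b] assms(3) vN by simp
    qed
    moreover have "distinct ((ws @ [v i]) @ rev [b..<v i])"
      using assms(1,3,4) ws(2) by (fastforce simp: reaches_rung_def)
    moreover have "\<forall>w \<in> set ((ws @ [v i]) @ rev [b..<v i]). w \<le> u i \<or> b \<le> w"
      using ws(2) assms(3) by fastforce
    ultimately show ?thesis using assms ne
      by (intro exI[of _ "(ws @ [v i]) @ rev [b..<v i]"]) (auto simp: reaches_rung_def last_append last_rev)
  qed
qed

lemma ex_reaches_rung: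
  assumes "length ss < K" "ss \<noteq> []" "\<not> hd ss"
  shows "\<exists>ws. reaches_rung (length ss) ss ws"
  using assms
proof (induct ss rule: rev_induct)
  case Nil
  then show ?case by simp
next
  case (snoc s ss)
  show ?case
  proof (cases "ss = []")
    case True
    have "v 1 < v 0" "v 0 \<le> y" using v_anti[of 0 1] between[of 0] K by auto
    moreover have "spells R ([y] @ rev [v 1..<last [y]]) ([] @ [False])"
      using calculation y_less by (intro spells_new_down[of N]) (auto simp: rail spells_Nil)
    ultimately have "reaches_rung 1 [False] (y # rev [v 1..<y])"
      by (auto simp: reaches_rung_def last_rev)
    then show ?thesis using True snoc.prems(3) by auto
  next
    case False
    let ?i = "length ss"
    obtain ws where ws: "reaches_rung ?i ss ws" using snoc False by auto
    have i: "?i < K" "Suc ?i < K" using snoc.prems(1) by auto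
    have lt: "u ?i < u (Suc ?i)" "v (Suc ?i) < v ?i" "u (Suc ?i) < v (Suc ?i)"
      using u_mono[of ?i "Suc ?i"] v_anti[of ?i "Suc ?i"] between[OF i(2)] i by auto
    show ?thesis
    proof (cases s)
      case True
      obtain ws' where "spells R ws' (ss @ [True])" "distinct ws'" "hd ws' = y" "last ws' = u (Suc ?i)"
        "\<forall>w \<in> set ws'. w \<le> u (Suc ?i) \<or> v ?i \<le> w"
        using forward_letter_step[OF ws i(1), of "u (Suc ?i)"] lt by auto
      then have "reaches_rung (Suc ?i) (ss @ [True]) ws'" using lt by (auto simp: reaches_rung_def)
      then show ?thesis using True by auto
    next
      case False
      obtain ws' where "spells R ws' (ss @ [False])" "distinct ws'" "hd ws' = y" "last ws' = v (Suc ?i)"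
        "\<forall>w \<in> set ws'. w \<le> u ?i \<or> v (Suc ?i) \<le> w"
        using backward_letter_step[OF ws i(1), of "v (Suc ?i)"] lt by auto
      then have "reaches_rung (Suc ?i) (ss @ [False]) ws'" using lt by (auto simp: reaches_rung_def)
      then show ?thesis using False by auto
    qed
  qed
qed

text \<open>
  The walk consumes one rung for each letter, reads its final forward letter from rung \<open>K - 1\<close> up to
  \<open>x\<close>, and is closed by the crossing edge. In the direction from \<open>x\<close> to \<open>y\<close> this edge prolongs the
  last letter, which is a forward one; in the other direction it is put in front of the walk and
  prolongs the first letter, which is a backward one.
\<close>

theorem ex_cycle_spelling:
  assumes "length ss = K" "\<not> hd ss" "last ss"
  shows "\<exists>ws. spells R ws ss \<and> hd ws = last ws \<and> distinct (tl ws)"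
proof -
  define ts where "ts = butlast ss"
  have ss: "ss = ts @ [True]" using assms K by (cases ss rule: rev_cases) (auto simp: ts_def)
  have "length ts = K - 1" "ts \<noteq> []" using assms(1) K ss by auto
  then have ts: "length ts = K - 1" "ts \<noteq> []" "\<not> hd ts" using assms(2) ss by (auto simp: hd_append)
  obtain ws where ws: "reaches_rung (K - 1) ts ws" using ex_reaches_rung[of ts] ts K by auto
  have "K - 1 < K" using K by simp
  then obtain ws' where ws': "spells R ws' ss" "distinct ws'" "hd ws' = y" "last ws' = x"
    using forward_letter_step[OF ws, of x] between ss by blast
  have ne: "ws' \<noteq> []" using ws'(1) unfolding spells_def by auto
  show ?thesis
    using crossing
  proof
    assume "(x, y) \<in> R"
    then have "spells R (ws' @ [y]) ss"
      using ws' assms ss by (intro spells_extend_last) (auto simp: signed_arc_def)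
    moreover have "distinct (tl (ws' @ [y]))" using ws'(2,3) ne by (cases ws') auto
    ultimately show ?thesis using ws'(3) ne by (intro exI[of _ "ws' @ [y]"]) auto
  next
    assume "(y, x) \<in> R"
    moreover obtain ss' where "ss = False # ss'" using assms K by (cases ss) auto
    ultimately have "spells R (x # ws') ss"
      using ws' by (auto simp: signed_arc_def intro!: spells_extend_first)
    then show ?thesis using ws' ne by (intro exI[of _ "x # ws'"]) auto
  qed
qed

end

section \<open>Oriented cycles as words\<close>

definition signed_cycle_arc :: "'a list \<Rightarrow> bool list \<Rightarrow> nat \<Rightarrow> 'a \<times> 'a" where
  "signed_cycle_arc cs ss i =
     (let a = cs ! i; b = cs ! (Suc i mod length cs) in if ss ! i then (a, b) else (b, a))"

text \<open>
  The vertices of an oriented cycle in cyclic order, together with the word that tells for each arc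
  whether it points along this order.
\<close>

definition cycle_word :: "'a pair_pre_digraph \<Rightarrow> 'a list \<Rightarrow> bool list \<Rightarrow> bool" where
  "cycle_word C cs ss \<longleftrightarrow> length ss = length cs \<and> 3 \<le> length cs \<and> distinct cs \<and>
     set cs = pverts C \<and> parcs C = signed_cycle_arc cs ss ` {..<length cs}"

text \<open>
  In a cyclic order of at least three vertices, different consecutive pairs are different as
  unordered pairs too.
\<close>

lemma signed_cycle_arc_inj:
  assumes "distinct cs" "3 \<le> length cs" "i < length cs" "j < length cs"
    and "signed_cycle_arc cs ss i = signed_cycle_arc cs ss j"
  shows "i = j"
proof -
  let ?n = "length cs"
  have "0 < ?n" using assms(2) by linarith
  then have lt: "Suc i mod ?n < ?n" "Suc j mod ?n < ?n" by simp_all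
  have "{cs ! i, cs ! (Suc i mod ?n)} = {cs ! j, cs ! (Suc j mod ?n)}"
    using assms(5) by (auto simp: signed_cycle_arc_def Let_def split: if_splits)
  then have "i = j \<or> i = Suc j mod ?n \<and> Suc i mod ?n = j"
    using nth_eq_iff_index_eq[OF assms(1)] assms(3,4) lt unfolding doubleton_eq_iff by metis
  then show ?thesis using assms(2-4) by (auto simp: mod_Suc split: if_splits)
qed

lemma pcas_segment:
  "a \<le> b \<Longrightarrow> pcas (w a) (map (\<lambda>j. (w j, w (Suc j))) [a..<b]) (w b)"
  by (induct b rule: dec_induct) (auto simp: pcas_append)

lemma pcas_rev: "pcas u p v \<Longrightarrow> pcas v (rev (map prod.swap p)) u"
  by (induct p arbitrary: u) (auto simp: pcas_append)

text \<open>
  The starts of the runs serve as branch vertices, and the run of a letter as the path that replaces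
  its arc; for a backward letter the run is read in reverse. The runs are internally disjoint because
  the closed walk repeats no vertex except for its start.
\<close>

lemma contains_subdivision_of_cycle_word:
  fixes H :: "'a pair_pre_digraph" and C :: "'b pair_pre_digraph"
  assumes "pair_wf_digraph H" and C: "cycle_word C cs ss"
    and ws: "spells (parcs H) ws ss" "hd ws = last ws" "distinct (tl ws)"
  shows "contains_subdivision H C"
proof -
  interpret H: pair_wf_digraph H by fact
  define n where "n = length cs"
  have n: "3 \<le> n" "length ss = n" "length cs = n" "distinct cs" "set cs = pverts C"
    "parcs C = signed_cycle_arc cs ss ` {..<n}"
    using C by (auto simp: cycle_word_def n_def)
  obtain h where h: "h 0 = 0" "length ws = Suc (h n)" "\<And>i. i < n \<Longrightarrow> h i < h (Suc i)"
    "\<And>i j. i < n \<Longrightarrow> h i \<le> j \<Longrightarrow> j < h (Suc i) \<Longrightarrow> signed_arc (parcs H) (ss ! i) (ws ! j) (ws ! Suc j)"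
    using ws(1) n(2) unfolding spells_def by auto
  define w where "w j = ws ! j" for j
  have h_less: "h i < h j" if "i < j" "j \<le> n" for i j using strict_mono_of_steps[of n h] h(3) that by blast
  have h_le: "h i \<le> h j" if "i \<le> j" "j \<le> n" for i j using mono_of_steps[of n h] h(3) that by blast
  have "ws \<noteq> []" using h(2) by auto
  then have closed: "w (h n) = w 0" using ws(2) h(2) by (simp add: w_def hd_conv_nth last_conv_nth)
  have inj_pos: "j = j'" if "w j = w j'" "0 < j" "0 < j'" "j \<le> h n" "j' \<le> h n" for j j'
  proof -
    have "tl ws ! (j - 1) = tl ws ! (j' - 1)" using that h(2) by (simp add: nth_tl w_def)
    then have "j - 1 = j' - 1" using ws(3) that h(2) by (subst (asm) nth_eq_iff_index_eq) auto
    then show ?thesis using that by simp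
  qed
  have w_inj: "j = j'" if "w j = w j'" "j < h n" "j' < h n" for j j'
  proof -
    have "k = 0" if "w k = w 0" "k < h n" for k
      using inj_pos[of k "h n"] that closed by (cases k) auto
    then show ?thesis using that inj_pos[of j j'] by (cases "j = 0"; cases "j' = 0") force+
  qed
  have seg_inj: "inj_on w {h i..h (Suc i)}" if "i < n" for i
  proof -
    have "0 < h i \<or> h (Suc i) < h n"
    proof (cases "Suc i = n")
      case True
      then show ?thesis using h_less[of 0 i] n(1) h(1) that by auto
    next
      case False
      then show ?thesis using h_less[of "Suc i" n] that by auto
    qed
    then show ?thesis
      using inj_pos w_inj h_le[of "Suc i" n] that by (intro inj_onI) fastforce
  qed
  define P' where "P' i = (if ss ! i then map (\<lambda>j. (w j, w (Suc j))) [h i..<h (Suc i)]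
    else rev (map prod.swap (map (\<lambda>j. (w j, w (Suc j))) [h i..<h (Suc i)])))" for i
  define arc where "arc = signed_cycle_arc cs ss"
  have arc_inj: "inj_on arc {..<n}"
    unfolding arc_def by (rule inj_onI, rule signed_cycle_arc_inj[of cs _ _ ss]) (use n in auto)
  define P where "P e = P' (the_inv_into {..<n} arc e)" for e
  have P: "P (arc i) = P' i" if "i < n" for i
    using that arc_inj by (simp add: P_def the_inv_into_f_f)
  have cs_inj: "inj_on (\<lambda>i. cs ! i) {..<n}" using n by (simp add: inj_on_nth)
  define f where "f c = w (h (the_inv_into {..<n} (\<lambda>i. cs ! i) c))" for c
  have f: "f (cs ! i) = w (h i)" if "i < n" for i
    using that cs_inj by (simp add: f_def the_inv_into_f_f)
  have f': "f (cs ! (Suc i mod n)) = w (h (Suc i))" if "i < n" for i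
  proof (cases "Suc i = n")
    case True
    then show ?thesis using f[of 0] n(1) h(1) closed by simp
  next
    case False
    then show ?thesis using f[of "Suc i"] that by simp
  qed
  have verts: "pverts C = (\<lambda>i. cs ! i) ` {..<n}" using n by (auto simp: set_conv_nth)
  have fverts: "f ` pverts C = (\<lambda>i. w (h i)) ` {..<n}"
    unfolding verts image_image using f by auto
  have setP': "set (P' i) = (\<lambda>j. if ss ! i then (w j, w (Suc j)) else (w (Suc j), w j)) ` {h i..<h (Suc i)}" for i
    by (auto simp: P'_def image_iff)
  have inner: "set (tl (map fst (P' i))) = w ` {h i<..<h (Suc i)}" if "i < n" for i
  proof -
    have lt: "h i < h (Suc i)" using h(3) that .
    show ?thesis
    proof (cases "ss ! i")
      case True
      have "tl [h i..<h (Suc i)] = [Suc (h i)..<h (Suc i)]" using lt by (simp add: upt_conv_Cons)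
      then show ?thesis using True by (auto simp: P'_def map_tl[symmetric] comp_def)
    next
      case False
      obtain k where k: "h (Suc i) = Suc k" "h i \<le> k" using lt by (cases "h (Suc i)") auto
      have "map fst (P' i) = map (\<lambda>j. w (Suc j)) (rev [h i..<h (Suc i)])"
        using False by (simp add: P'_def rev_map comp_def)
      also have "tl \<dots> = map (\<lambda>j. w (Suc j)) (rev [h i..<k])" using k by simp
      finally have "set (tl (map fst (P' i))) = (\<lambda>j. w (Suc j)) ` {h i..<k}" by simp
      also have "\<dots> = w ` (Suc ` {h i..<k})" by (simp only: image_image)
      also have "Suc ` {h i..<k} = {h i<..<h (Suc i)}" using k by (auto simp: image_Suc_atLeastLessThan)
      finally show ?thesis .
    qed
  qed
  have inner_branch: "w ` {h i<..<h (Suc i)} \<inter> f ` pverts C = {}" if "i < n" for i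
  proof -
    have "w j \<noteq> w (h k)" if "h i < j" "j < h (Suc i)" "k < n" for j k
    proof
      assume eq: "w j = w (h k)"
      have "j < h n" "h k < h n" using that \<open>i < n\<close> h_le[of "Suc i" n] h_less[of k n] by auto
      then have "j = h k" using w_inj eq by blast
      then show False using that h_le[of k i] h_le[of "Suc i" k] \<open>i < n\<close> by (cases "k \<le> i") auto
    qed
    then show ?thesis unfolding fverts by auto
  qed
  have inner_disjoint: "w ` {h i<..<h (Suc i)} \<inter> w ` {h k<..<h (Suc k)} = {}" if "i < n" "k < n" "i \<noteq> k" for i k
  proof -
    have "w j \<noteq> w l" if "j \<in> {h i<..<h (Suc i)}" "l \<in> {h k<..<h (Suc k)}" for j l
    proof
      assume eq: "w j = w l"
      have "j < h n" "l < h n" using that \<open>i < n\<close> \<open>k < n\<close> h_le[of "Suc i" n] h_le[of "Suc k" n] by auto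
      then have "j = l" using w_inj eq by blast
      then show False using that h_le[of "Suc i" k] h_le[of "Suc k" i] \<open>i < n\<close> \<open>k < n\<close> \<open>i \<noteq> k\<close>
        by (cases "i < k") auto
    qed
    then show ?thesis by blast
  qed
  define S :: "'a pair_pre_digraph" where
    "S = \<lparr>pverts = f ` pverts C \<union> (\<Union>e \<in> parcs C. set (tl (map fst (P e)))),
      parcs = (\<Union>e \<in> parcs C. set (P e))\<rparr>"
  have arcsC: "parcs C = arc ` {..<n}" using n by (simp add: arc_def)
  have S_arcs: "parcs S = (\<Union>i<n. set (P' i))" using P by (auto simp: S_def arcsC)
  have S_verts: "pverts S = (\<lambda>i. w (h i)) ` {..<n} \<union> (\<Union>i<n. w ` {h i<..<h (Suc i)})"
    using P inner by (simp add: S_def arcsC fverts)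
  have w_S: "w j \<in> pverts S" if ij: "i < n" "h i \<le> j" "j \<le> h (Suc i)" for i j
  proof -
    consider "j = h i" | "h i < j" "j < h (Suc i)" | "j = h (Suc i)" using ij by linarith
    then show ?thesis
    proof cases
      case 2
      then have "w j \<in> w ` {h i<..<h (Suc i)}" by auto
      then show ?thesis using ij(1) S_verts by blast
    next
      case 3
      then have "w j = f (cs ! (Suc i mod n))" using f' that by simp
      moreover have "Suc i mod n < n" using n(1) by simp
      ultimately have "w j \<in> f ` pverts C" using verts by blast
      then show ?thesis by (simp add: S_def)
    qed (use that S_verts in auto)
  qed
  have S_arcE: "\<exists>i j. i < n \<and> h i \<le> j \<and> j < h (Suc i) \<and>
      e = (if ss ! i then (w j, w (Suc j)) else (w (Suc j), w j))" if "e \<in> parcs S" for e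
    using that unfolding S_arcs setP' by fastforce
  have S_sub: "parcs S \<subseteq> parcs H"
  proof
    fix e assume "e \<in> parcs S"
    then obtain i j where "i < n" "h i \<le> j" "j < h (Suc i)"
      "e = (if ss ! i then (w j, w (Suc j)) else (w (Suc j), w j))" using S_arcE by blast
    then show "e \<in> parcs H" using h(4)[of i j] by (auto simp: signed_arc_def w_def)
  qed
  have S_ends: "fst e \<in> pverts S \<and> snd e \<in> pverts S" if e: "e \<in> parcs S" for e
  proof -
    obtain i j where "i < n" "h i \<le> j" "j < h (Suc i)"
      "e = (if ss ! i then (w j, w (Suc j)) else (w (Suc j), w j))" using S_arcE[OF e] by blast
    then show ?thesis using w_S[of i j] w_S[of i "Suc j"] by auto
  qed
  then have S_wf: "pair_wf_digraph S" by unfold_locales auto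
  have S_vsub: "pverts S \<subseteq> pverts H"
  proof -
    have "w j \<in> pverts H" if "i < n" "h i \<le> j" "j < h (Suc i)" for i j
      using h(4)[OF that] by (auto simp: signed_arc_def w_def dest: H.in_arcsD1 H.in_arcsD2 split: if_splits)
    then show ?thesis unfolding S_verts using h(3) by force
  qed
  have sub: "subgraph (with_proj S) (with_proj H)"
    unfolding subgraph_def using S_sub S_vsub S_wf H.wf_digraph_axioms
    by (auto simp: wf_digraph_wp_iff)
  have path: "pre_digraph.gen_iapath S (f ` pverts C) (f (fst (arc i))) (P' i) (f (snd (arc i)))"
    if i: "i < n" for i
  proof -
    let ?q = "map (\<lambda>j. (w j, w (Suc j))) [h i..<h (Suc i)]"
    have lt: "h i < h (Suc i)" using h(3) i .
    have q: "pcas (w (h i)) ?q (w (h (Suc i)))" using lt by (intro pcas_segment) simp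
    have vq: "map fst ?q @ [w (h (Suc i))] = map w [h i..<Suc (h (Suc i))]" using lt by simp
    have dq: "distinct (map fst ?q @ [w (h (Suc i))])"
      unfolding vq distinct_map using seg_inj[OF i] by (auto simp: atLeastLessThanSuc_atLeastAtMost simp del: upt_Suc)
    have ends: "f (fst (arc i)) = (if ss ! i then w (h i) else w (h (Suc i)))"
      "f (snd (arc i)) = (if ss ! i then w (h (Suc i)) else w (h i))"
      using f[OF i] f'[OF i] n(3) by (auto simp: arc_def signed_cycle_arc_def Let_def)
    have walk: "pcas (f (fst (arc i))) (P' i) (f (snd (arc i)))"
      using q pcas_rev[OF q] unfolding ends P'_def by simp
    have "distinct (pawalk_verts (f (fst (arc i))) (P' i))"
    proof (cases "ss ! i")
      case True
      then show ?thesis using pcas_verts(2)[OF walk] dq by (simp add: ends P'_def)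
    next
      case False
      then have "pawalk_verts (f (fst (arc i))) (P' i) = rev (map fst ?q @ [w (h (Suc i))])"
        using pcas_verts(1)[OF walk] by (simp add: ends P'_def rev_map comp_def)
      then show ?thesis using dq by (simp only: distinct_rev)
    qed
    moreover have "cs ! i \<in> pverts C" "cs ! (Suc i mod n) \<in> pverts C"
      using n(1,3) i unfolding n(5)[symmetric] by (auto intro!: nth_mem)
    then have "fst (arc i) \<in> pverts C" "snd (arc i) \<in> pverts C"
      using n(3) by (auto simp: arc_def signed_cycle_arc_def Let_def)
    moreover have "P' i \<noteq> []" using lt by (simp add: P'_def)
    moreover have "set (P' i) \<subseteq> parcs S" using i by (auto simp: S_arcs)
    moreover have "set (tl (map fst (P' i))) \<inter> f ` pverts C = {}"
      using inner[OF i] inner_branch[OF i] by simp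
    ultimately show ?thesis
      unfolding pre_digraph.gen_iapath_def pre_digraph.apath_def pre_digraph.awalk_def
        cas_with_proj_eq awalk_verts_with_proj_eq inner_verts_with_proj_def
      using walk by (simp add: S_def)
  qed
  have "inj_on f (pverts C)"
  proof -
    have "h i < h n" if "i < n" for i using h_less that by simp
    then have h_inj: "i = j" if "w (h i) = w (h j)" "i < n" "j < n" for i j
      using w_inj[of "h i" "h j"] h_less[of i j] h_less[of j i] that by (cases i j rule: linorder_cases) auto
    show ?thesis
    proof (rule inj_onI)
      fix a b assume ab: "a \<in> pverts C" "b \<in> pverts C" "f a = f b"
      then obtain i j where "i < n" "j < n" "a = cs ! i" "b = cs ! j" unfolding verts by auto
      then show "a = b" using ab(3) f[of i] f[of j] h_inj[of i j] by simp
    qed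
  qed
  moreover have "\<forall>(a, b) \<in> parcs C. pre_digraph.gen_iapath S (f ` pverts C) (f a) (P (a, b)) (f b)"
  proof
    fix e assume "e \<in> parcs C"
    then obtain i where "i < n" "e = arc i" by (auto simp: arcsC)
    then show "case e of (a, b) \<Rightarrow> pre_digraph.gen_iapath S (f ` pverts C) (f a) (P (a, b)) (f b)"
      using path[of i] P[of i] by (cases "arc i") auto
  qed
  moreover have "set (tl (map fst (P e))) \<inter> set (tl (map fst (P e'))) = {}"
    if e: "e \<in> parcs C" "e' \<in> parcs C" "e \<noteq> e'" for e e'
  proof -
    obtain i k where "i < n" "k < n" "e = arc i" "e' = arc k" using e by (auto simp: arcsC)
    then show ?thesis using e(3) P inner inner_disjoint[of i k] by auto
  qed
  ultimately have "is_subdivision_of S C"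
    unfolding is_subdivision_of_def inner_verts_with_proj_def
    by (intro exI[of _ f] exI[of _ P]) (simp add: S_def)
  then show ?thesis unfolding contains_subdivision_def using sub by blast
qed

lemma cycle_word_rotate:
  assumes "cycle_word C cs ss" "k < length cs"
  shows "cycle_word C (rotate k cs) (rotate k ss)"
proof -
  let ?n = "length cs"
  have n: "length ss = ?n" "3 \<le> ?n" using assms(1) by (auto simp: cycle_word_def)
  have n0: "0 < ?n" using n by linarith
  have arc: "signed_cycle_arc (rotate k cs) (rotate k ss) i = signed_cycle_arc cs ss ((k + i) mod ?n)" if "i < ?n" for i
    using that n n0 by (simp add: signed_cycle_arc_def Let_def nth_rotate mod_simps)
  have "(\<lambda>i. (k + i) mod ?n) ` {..<?n} = {..<?n}"
  proof
    show "{..<?n} \<subseteq> (\<lambda>i. (k + i) mod ?n) ` {..<?n}"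
    proof
      fix j assume j: "j \<in> {..<?n}"
      have "(k + (j + (?n - k)) mod ?n) mod ?n = (k + (j + (?n - k))) mod ?n" by (simp add: mod_simps)
      also have "\<dots> = j" using j assms(2) by simp
      finally show "j \<in> (\<lambda>i. (k + i) mod ?n) ` {..<?n}"
        using n0 by (intro image_eqI[of _ _ "(j + (?n - k)) mod ?n"]) auto
    qed
  qed (use n0 in auto)
  then have "signed_cycle_arc (rotate k cs) (rotate k ss) ` {..<?n} = signed_cycle_arc cs ss ` {..<?n}"
    using arc by (metis (no_types, lifting) image_cong image_image lessThan_iff)
  then show ?thesis using assms(1) by (simp add: cycle_word_def)
qed

text \<open>
  Both directions occur in a cycle that is not directed. Hence a backward arc follows a forward
  arc somewhere, and the cyclic order may start there.
\<close>

lemma ex_cycle_word: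
  assumes "oriented_cycle C" "\<not> directed_cycle C"
  shows "\<exists>cs ss. cycle_word C cs ss \<and> \<not> hd ss \<and> last ss"
proof -
  interpret oriented_graph C using assms(1) by (simp add: oriented_cycle_def)
  obtain p where "pre_digraph.cycle (mk_symmetric C) p" and len: "3 \<le> length p"
    and verts: "pverts C = fst ` set p" and arcs: "parcs (mk_symmetric C) = set p \<union> (set p)\<inverse>"
    using assms(1) by (auto simp: oriented_cycle_def is_cycle_graph_def)
  then obtain u where u: "pcas u p u" "distinct (map snd p)" "u \<in> pverts C"
    using pcas_verts(1) by (force simp: pre_digraph.cycle_def pre_digraph.awalk_def cas_with_proj_eq
        awalk_verts_with_proj_eq)
  have arcs: "parcs C \<union> (parcs C)\<inverse> = set p \<union> (set p)\<inverse>"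
    using arcs by (auto simp: parcs_mk_symmetric)
  define cs where "cs = map fst p"
  define ss where "ss = map (\<lambda>e. e \<in> parcs C) p"
  let ?n = "length p"
  have vs: "u # map snd p = cs @ [u]" using pcas_verts[OF u(1)] by (simp add: cs_def)
  from vs have "mset (u # map snd p) = mset (cs @ [u])" by (rule arg_cong)
  then have ms: "mset (map snd p) = mset cs" by (simp del: mset_map)
  then have dist: "distinct cs" using u(2) ms mset_eq_imp_distinct_iff by blast
  have snd_p: "snd (p ! i) = cs ! (Suc i mod ?n)" if "i < ?n" for i
  proof -
    have "snd (p ! i) = (u # map snd p) ! Suc i" using that by simp
    also have "\<dots> = cs ! (Suc i mod ?n)"
    proof (cases "Suc i = ?n")
      case True
      have "cs ! 0 = u" using arg_cong[OF vs, of hd] that by (cases p) (auto simp: cs_def)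
      then show ?thesis using True unfolding vs by (simp add: nth_append cs_def)
    next
      case False
      then show ?thesis using that unfolding vs by (simp add: nth_append cs_def)
    qed
    finally show ?thesis .
  qed
  have arc: "signed_cycle_arc cs ss i = (if p ! i \<in> parcs C then p ! i else prod.swap (p ! i))" if "i < ?n" for i
    using that snd_p[OF that] by (auto simp: signed_cycle_arc_def ss_def cs_def Let_def prod_eq_iff)
  have "parcs C = signed_cycle_arc cs ss ` {..<?n}"
  proof
    show "parcs C \<subseteq> signed_cycle_arc cs ss ` {..<?n}"
    proof
      fix e assume e: "e \<in> parcs C"
      then have "e \<in> set p \<or> prod.swap e \<in> set p" using arcs by (cases e) auto
      then obtain i where i: "i < ?n" "p ! i = e \<or> p ! i = prod.swap e" by (auto simp: in_set_conv_nth)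
      then have "signed_cycle_arc cs ss i = e"
        using arc[OF i(1)] e no_opposite_arcs[of "fst e" "snd e"] by (cases e) auto
      then show "e \<in> signed_cycle_arc cs ss ` {..<?n}" using i(1) by auto
    qed
    show "signed_cycle_arc cs ss ` {..<?n} \<subseteq> parcs C"
    proof
      fix e assume "e \<in> signed_cycle_arc cs ss ` {..<?n}"
      then obtain i where i: "i < ?n" "e = signed_cycle_arc cs ss i" by auto
      have "p ! i \<in> parcs C \<union> (parcs C)\<inverse>" using i(1) arcs by auto
      then show "e \<in> parcs C" using arc[OF i(1)] i(2) by (cases "p ! i") auto
    qed
  qed
  then have word: "cycle_word C cs ss"
    using len dist verts by (simp add: cycle_word_def cs_def ss_def)
  have not_along: "\<not> set q \<subseteq> parcs C" if "q = p \<or> q = rev (map prod.swap p)" for q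
  proof
    assume q: "set q \<subseteq> parcs C"
    have "parcs C \<subseteq> set q"
    proof
      fix e assume e: "e \<in> parcs C"
      have "x \<in> set (rev (map prod.swap p)) \<longleftrightarrow> prod.swap x \<in> set p" for x by force
      moreover have "e \<in> set p \<or> prod.swap e \<in> set p" using e arcs by (cases e) auto
      ultimately have "e \<in> set q \<or> prod.swap e \<in> set q" using that by (metis swap_swap)
      then show "e \<in> set q" using q e no_opposite_arcs[of "fst e" "snd e"] by (cases e) auto
    qed
    moreover have walk: "pcas u q u" using that u(1) pcas_rev[OF u(1)] by auto
    moreover have "distinct (map snd q)"
    proof -
      have "map snd (rev (map prod.swap p)) = rev cs" by (simp add: cs_def rev_map comp_def)
      then show ?thesis using that u(2) dist by (metis distinct_rev)
    qed
    moreover have "fst ` set q = pverts C"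
    proof -
      have "snd ` set p = fst ` set p" using arg_cong[OF ms, of set_mset] by (simp add: cs_def)
      moreover have "fst ` set (rev (map prod.swap p)) = snd ` set p" by (simp add: image_image)
      ultimately show ?thesis using that verts by metis
    qed
    moreover have "q \<noteq> []" using that len by auto
    ultimately have "directed_cycle C"
      unfolding directed_cycle_def pre_digraph.cycle_def pre_digraph.awalk_def cas_with_proj_eq
        awalk_verts_with_proj_eq
      using q u(3) pcas_verts(1)[OF walk] by (intro exI[of _ q] conjI exI[of _ u]) auto
    then show False using assms(2) by simp
  qed
  have n: "length ss = ?n" "length cs = ?n" "0 < ?n" using len by (auto simp: ss_def cs_def)
  obtain a where a: "a < ?n" "\<not> ss ! a"
    using not_along[of p] by (auto simp: ss_def in_set_conv_nth subset_iff)
  obtain b where b: "b < ?n" "ss ! b"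
  proof -
    have "\<exists>e \<in> set p. prod.swap e \<notin> parcs C" using not_along[of "rev (map prod.swap p)"] by force
    then obtain b where "b < ?n" "prod.swap (p ! b) \<notin> parcs C" by (auto simp: in_set_conv_nth)
    moreover from this have "p ! b \<in> parcs C"
      using arcs nth_mem[of b p] by (cases "p ! b") auto
    ultimately show thesis using that by (simp add: ss_def)
  qed
  have "\<exists>i. ss ! (i mod ?n) \<and> \<not> ss ! (Suc i mod ?n)"
  proof (rule ccontr)
    assume "\<not> ?thesis"
    then have "ss ! ((b + j) mod ?n)" for j by (induct j) (use b in auto)
    from this[of "a + (?n - b)"] show False using a b by simp
  qed
  then obtain i where i: "ss ! (i mod ?n)" "\<not> ss ! (Suc i mod ?n)" by blast
  define k where "k = Suc i mod ?n"
  have k: "k < ?n" using n by (simp add: k_def)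
  have "hd (rotate k ss) = rotate k ss ! 0" using n by (intro hd_conv_nth) auto
  also have "\<dots> = ss ! k" using n k by (simp add: nth_rotate)
  finally have "\<not> hd (rotate k ss)" using i(2) by (simp add: k_def)
  moreover have "last (rotate k ss)"
  proof -
    have "last (rotate k ss) = ss ! ((k + (?n - 1)) mod ?n)"
      using n by (subst last_conv_nth) (auto simp: nth_rotate)
    also have "(k + (?n - 1)) mod ?n = (Suc i + (?n - 1)) mod ?n" by (simp add: k_def mod_simps)
    also have "Suc i + (?n - 1) = i + ?n" using n by simp
    finally show ?thesis using i(1) by simp
  qed
  ultimately show ?thesis using cycle_word_rotate[OF word, of k] k n by auto
qed

section \<open>Subdivisions in digraphs with a Hamiltonian directed path\<close>

lemma ex_interval_of_steps:
  fixes h :: "nat \<Rightarrow> nat"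
  assumes "h 0 \<le> j" "j < h n"
  shows "\<exists>i < n. h i \<le> j \<and> j < h (Suc i)"
  using assms(2)
proof (induct n)
  case 0
  then show ?case using assms(1) by simp
next
  case (Suc n)
  then show ?case by (cases "j < h n") (auto simp: less_Suc_eq)
qed

lemma spells_subset_Field:
  assumes "spells R ws ss" "ss \<noteq> []"
  shows "set ws \<subseteq> Field R"
proof
  fix w assume "w \<in> set ws"
  obtain h where h: "h 0 = 0" "length ws = Suc (h (length ss))" "\<And>i. i < length ss \<Longrightarrow> h i < h (Suc i)"
    "\<And>i j. i < length ss \<Longrightarrow> h i \<le> j \<Longrightarrow> j < h (Suc i) \<Longrightarrow> signed_arc R (ss ! i) (ws ! j) (ws ! Suc j)"
    using assms(1) unfolding spells_def by blast
  have step: "ws ! j \<in> Field R \<and> ws ! Suc j \<in> Field R" if j: "j < h (length ss)" for j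
  proof -
    obtain i where "i < length ss" "h i \<le> j" "j < h (Suc i)"
      using ex_interval_of_steps[of h j "length ss"] h(1) j by auto
    then show ?thesis using h(4)[of i j] by (auto simp: signed_arc_def Field_def split: if_splits)
  qed
  have "0 < h (length ss)" using strict_mono_of_steps[of "length ss" h 0 "length ss"] h(1,3) assms(2) by auto
  moreover obtain k where "k \<le> h (length ss)" "w = ws ! k"
    using \<open>w \<in> set ws\<close> h(2) by (auto simp: in_set_conv_nth less_Suc_eq_le)
  ultimately show "w \<in> Field R" using step[of k] step[of "k - 1"] by (cases "k = h (length ss)") auto
qed

lemma dipath_consecutive:
  assumes "pcas u p v" "Suc i < length (pawalk_verts u p)"
  shows "(pawalk_verts u p ! i, pawalk_verts u p ! Suc i) \<in> set p"
proof -
  have i: "i < length p" using assms pcas_verts(1)[OF assms(1)] by simp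
  then have "pawalk_verts u p ! i = fst (p ! i)" "pawalk_verts u p ! Suc i = snd (p ! i)"
    using pcas_verts[OF assms(1)] by (metis length_map nth_append nth_map, metis nth_Cons_Suc nth_map)
  then show ?thesis using i by simp
qed

text \<open>
  Vertices are replaced by their positions on the Hamiltonian path. A subgraph of minimum degree
  at least \<open>9 * n - 3\<close> exists, so its positions carry a rainbow of \<open>n\<close> edges crossed by a further edge.
\<close>

theorem contains_subdivision_of_large_chromatic_number:
  fixes H :: "'a pair_pre_digraph" and C :: "'b pair_pre_digraph"
  assumes H: "oriented_graph H" "has_hamiltonian_dipath H"
    and C: "oriented_cycle C" "\<not> directed_cycle C"
    and chi: "9 * card (pverts C) - 3 < chromatic_number H"
  shows "contains_subdivision H C"
proof -
  interpret H: oriented_graph H by fact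
  obtain cs ss where word: "cycle_word C cs ss" "\<not> hd ss" "last ss"
    using ex_cycle_word[OF C] by blast
  define n where "n = card (pverts C)"
  have n: "length ss = n" "3 \<le> n"
    using word(1) distinct_card[of cs] by (auto simp: cycle_word_def n_def)
  obtain X where X: "X \<subseteq> pverts H" "X \<noteq> {}"
    "\<And>x. x \<in> X \<Longrightarrow> 9 * n - 3 \<le> card {y \<in> X. (x, y) \<in> parcs H \<or> (y, x) \<in> parcs H}"
    using ex_subset_of_large_degree[OF H(1) chi] unfolding n_def by blast
  obtain a p b where path: "pcas a p b" "set p \<subseteq> parcs H" "distinct (pawalk_verts a p)"
    "set (pawalk_verts a p) = pverts H"
    using H(2) by (auto simp: has_hamiltonian_dipath_def pre_digraph.apath_def pre_digraph.awalk_def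
        cas_with_proj_eq awalk_verts_with_proj_eq)
  define vs where "vs = pawalk_verts a p"
  define N where "N = length vs"
  define R where "R = {(i, j). i < N \<and> j < N \<and> (vs ! i, vs ! j) \<in> parcs H}"
  define I where "I = {i. i < N \<and> vs ! i \<in> X}"
  define E where "E = (\<lambda>(i, j). (real i, real j)) ` {(i, j). i < j \<and> i \<in> I \<and> j \<in> I \<and> ((i, j) \<in> R \<or> (j, i) \<in> R)}"
  have E: "(r, s) \<in> E \<longleftrightarrow> (\<exists>i j. r = real i \<and> s = real j \<and> i < j \<and> i \<in> I \<and> j \<in> I \<and> ((i, j) \<in> R \<or> (j, i) \<in> R))" for r s
    unfolding E_def by auto
  have finI: "finite I" by (simp add: I_def)
  have EW: "E \<subseteq> real ` I \<times> real ` I" by (auto simp: E_def)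
  then have finE: "finite E" using finI finite_subset by blast
  have index: "\<exists>j. j \<in> I \<and> vs ! j = y" if "y \<in> X" for y
  proof -
    have "y \<in> set vs" using that X(1) path(4) by (auto simp: vs_def)
    then show ?thesis using that by (auto simp: I_def N_def in_set_conv_nth)
  qed
  have degree: "9 * n - 3 \<le> degree_at E (real i)" if i: "i \<in> I" for i
  proof -
    let ?F = "{e \<in> E. fst e = real i \<or> snd e = real i}"
    \<comment> \<open>the end of \<open>e\<close> other than \<open>i\<close>\<close>
    define g where "g e = vs ! nat \<lfloor>if fst e = real i then snd e else fst e\<rfloor>" for e :: "real \<times> real"
    have "{y \<in> X. (vs ! i, y) \<in> parcs H \<or> (y, vs ! i) \<in> parcs H} \<subseteq> g ` ?F"
    proof
      fix y assume y: "y \<in> {y \<in> X. (vs ! i, y) \<in> parcs H \<or> (y, vs ! i) \<in> parcs H}"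
      then obtain j where j: "j \<in> I" "vs ! j = y" using index by blast
      have ij: "(i, j) \<in> R \<or> (j, i) \<in> R" using y i j by (auto simp: R_def I_def)
      have "i \<noteq> j" using y j H.no_loops' by auto
      then consider "i < j" | "j < i" by linarith
      then show "y \<in> g ` ?F"
      proof cases
        case 1
        then have edge: "(real i, real j) \<in> ?F" using i j(1) ij by (auto simp: E)
        moreover have "g (real i, real j) = y" using j by (simp add: g_def)
        ultimately show ?thesis using imageI[OF edge, of g] by (simp only:)
      next
        case 2
        then have edge: "(real j, real i) \<in> ?F" using i j(1) ij by (auto simp: E)
        moreover have "g (real j, real i) = y" using j 2 by (simp add: g_def)
        ultimately show ?thesis using imageI[OF edge, of g] by (simp only:)
      qed
    qed
    then have "card {y \<in> X. (vs ! i, y) \<in> parcs H \<or> (y, vs ! i) \<in> parcs H} \<le> card (g ` ?F)"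
      using finE by (intro card_mono) auto
    also have "\<dots> \<le> degree_at E (real i)" unfolding degree_at_def using finE by (intro card_image_le) auto
    finally show ?thesis using X(3)[of "vs ! i"] i by (auto simp: I_def)
  qed
  have "I \<noteq> {}" using X(2) index by blast
  then have "crossed_rainbow n E"
    using ex_low_degree_of_uncrossed[of "real ` I" E n] finI EW degree n(2)
    by (force simp: E_def not_less[symmetric])
  then obtain es x y where es: "length es = n" "set es \<subseteq> E" "sorted_wrt nested es"
    and xy: "(x, y) \<in> E" "\<And>e. e \<in> set es \<Longrightarrow> fst e < x \<and> x < snd e \<and> snd e \<le> y"
    unfolding crossed_rainbow_def by blast
  obtain x' y' where xy': "x = real x'" "y = real y'" "(x', y') \<in> R \<or> (y', x') \<in> R" "y' < N"
    using xy(1) by (auto simp: E I_def)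
  have "\<exists>i j. es ! k = (real i, real j) \<and> ((i, j) \<in> R \<or> (j, i) \<in> R)" if "k < n" for k
  proof -
    have "es ! k \<in> E" using es(1,2) that nth_mem by blast
    then show ?thesis by (auto simp: E_def)
  qed
  then obtain u v where uv: "\<And>k. k < n \<Longrightarrow> es ! k = (real (u k), real (v k)) \<and> ((u k, v k) \<in> R \<or> (v k, u k) \<in> R)"
    by metis
  have nest: "u i < u j \<and> v j < v i" if "i < j" "j < n" for i j
  proof -
    have "nested (es ! i) (es ! j)" using sorted_wrt_nth_less[OF es(3)] that es(1) by blast
    then show ?thesis using uv[of i] uv[of j] that by (simp add: nested_def)
  qed
  have "crossed_ladder N n R u v x' y'"
  proof
    show "(i, Suc i) \<in> R" if "Suc i < N" for i
      using dipath_consecutive[OF path(1), of i] path(2) that by (auto simp: R_def N_def vs_def)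
    show "u i < x' \<and> x' < v i \<and> v i \<le> y'" if "i < n" for i
      using xy(2)[OF nth_mem[of i es]] uv[OF that] that es(1) xy'(1,2) by simp
  qed (use nest uv xy' n(2) in auto)
  then obtain ws where ws: "spells R ws ss" "hd ws = last ws" "distinct (tl ws)"
    using crossed_ladder.ex_cycle_spelling[of N n R u v x' y' ss] n(1) word(2,3) by blast
  have "ss \<noteq> []" using n by auto
  then have in_N: "w < N" if "w \<in> set ws" for w
    using spells_subset_Field[OF ws(1)] that by (auto simp: R_def Field_def)
  show ?thesis
  proof (rule contains_subdivision_of_cycle_word[OF _ word(1)])
    show "spells (parcs H) (map ((!) vs) ws) ss"
      using ws(1) by (rule spells_map) (auto simp: R_def)
    have "ws \<noteq> []" using ws(1) unfolding spells_def by auto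
    then show "hd (map ((!) vs) ws) = last (map ((!) vs) ws)" using ws(2) by (simp add: hd_map last_map)
    have "inj_on ((!) vs) (set (tl ws))"
      using path(3) in_N \<open>ws \<noteq> []\<close> by (intro inj_on_nth) (auto simp: vs_def N_def list.set_sel(2))
    then show "distinct (tl (map ((!) vs) ws))" using ws(3) by (simp add: map_tl[symmetric] distinct_map)
  qed (rule H.pair_wf_digraph)
qed

theorem theorem4p1:
  fixes n :: nat
    and H :: "'a pair_pre_digraph"
    and C :: "'b pair_pre_digraph"
  assumes "0 < n"
    and "oriented_graph H"
    and "chromatic_number H = 12 * n - 5"
    and "has_hamiltonian_dipath H"
    and "oriented_cycle C"
    and "card (pverts C) = n"
    and "more_than_one_block C"
  shows "contains_subdivision H C"
proof (rule contains_subdivision_of_large_chromatic_number)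
  show "\<not> directed_cycle C" using assms(7) by (simp add: more_than_one_block_def)
  show "9 * card (pverts C) - 3 < chromatic_number H" using assms(1,3,6) by simp
qed (use assms in auto)

end
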